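(* Let $t$ be a positive integer. There exists a skew-symmetric EW matrix of order $4t+2$ if and only if there exists a tournament matrix $A$ with characteristic polynomial \[ \chi_A(x) = \left( x^3 - (2t-1)x^2 - t(4t-1) \right)\left( x^2+x+t \right)^{2t-1}. \]
   Context: $I_n$, $J_n$, $O_n$ denote the identity, all-ones and all-zeros matrices of order $n$. A $\{\pm1\}$-matrix $X$ is called skew-symmetric if $X+X^\top=2I$. An EW matrix of order $n$ is a $\{\pm1\}$-matrix $B$ of order $n$ such that \[ BB^\top = B^\top B = \begin{pmatrix} (n-2)I_{n/2}+2J_{n/2} & O_{n/2}\\ O_{n/2} & (n-2)I_{n/2}+2J_{n/2}\end{pmatrix}. \] A tournament matrix is a $\{0,1\}$-matrix $A$ with $A+A^\top=J-I$. $\chi_M(x)=\det(xI-M)$ denotes the characteristic polynomial. *)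

theory Defs
  imports "Jordan_Normal_Form.Char_Poly"
begin

definition all_ones_mat :: "nat \<Rightarrow> real mat" where
  "all_ones_mat n = mat n n (\<lambda>_. 1)"

definition pm1_matrix :: "nat \<Rightarrow> real mat \<Rightarrow> bool" where
  "pm1_matrix n X \<longleftrightarrow> X \<in> carrier_mat n n \<and> (\<forall>i<n. \<forall>j<n. X $$ (i, j) \<in> {1, -1})"

text \<open>For sign matrices, skew-symmetry does not mean that the transpose is the negative of the
  matrix: the diagonal consists of ones and only the off-diagonal part is skew.\<close>

definition skew_symmetric_pm1 :: "nat \<Rightarrow> real mat \<Rightarrow> bool" where
  "skew_symmetric_pm1 n X \<longleftrightarrow> pm1_matrix n X \<and> X + transpose_mat X = 2 \<cdot>\<^sub>m 1\<^sub>m n"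

definition EW_block :: "nat \<Rightarrow> real mat" where
  "EW_block n = (real n - 2) \<cdot>\<^sub>m 1\<^sub>m (n div 2) + 2 \<cdot>\<^sub>m all_ones_mat (n div 2)"

text \<open>Evenness of the order is implicit in the blocks having order n/2.\<close>

definition EW_matrix :: "nat \<Rightarrow> real mat \<Rightarrow> bool" where
  "EW_matrix n B \<longleftrightarrow> even n \<and> pm1_matrix n B \<and>
     B * transpose_mat B = transpose_mat B * B \<and>
     transpose_mat B * B =
       four_block_mat (EW_block n) (0\<^sub>m (n div 2) (n div 2))
                      (0\<^sub>m (n div 2) (n div 2)) (EW_block n)"

definition tournament_matrix :: "nat \<Rightarrow> real mat \<Rightarrow> bool" where
  "tournament_matrix n A \<longleftrightarrow> A \<in> carrier_mat n n \<and> (\<forall>i<n. \<forall>j<n. A $$ (i, j) \<in> {0, 1}) \<and>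
     A + transpose_mat A = all_ones_mat n - 1\<^sub>m n"

end

theory Submission imports Defs
begin

text \<open>Border the skew matrix K = A - A^T of a tournament A of order n = 4t + 1 by a row of ones and a
  column of minus ones to get a skew matrix S of order 4t + 2. Since adding a multiple of J changes a
  determinant affinely, det(xI - S), det(xI - K), det(xI - K - J) and det(xI - K + J) are
  all combinations of two quantities; the last two are values of the characteristic polynomial of A, at
  (x - 1)/2 and at (-x - 1)/2.

  If I + S is EW up to switching, then det(xI - S) = q^(2t) r with q = x^2 + 4t - 1 and
  r = x^2 + 8t + 1, and det(xI - K) is a cofactor of xI - S, which the explicit resolvent of S yields.
  These two determinants determine the characteristic polynomial of A.

  Conversely, the characteristic polynomial of A gives det(xI - S) = q^(2t) r. By Cayley-Hamilton and
  the symmetry of S^2, the matrix P = (-S^2 - (4t - 1)I)/2 satisfies P^2 = (2t + 1)P. It has integer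
  entries and unit diagonal, so its rows fall into two classes of size 2t + 1 within which they agree
  up to sign. Permuting the classes into blocks and switching signs turns I + S into an EW
  matrix.\<close>

section \<open>Entrywise products and values of characteristic polynomials\<close>

lemma index_mult_mat_sum:
  assumes "A \<in> carrier_mat n k" "B \<in> carrier_mat k m" "i < n" "j < m"
  shows "(A * B) $$ (i, j) = (\<Sum>l<k. A $$ (i, l) * B $$ (l, j))"
  using assms by (auto simp: scalar_prod_def atLeast0LessThan intro!: sum.cong)

lemma poly_char_poly:
  fixes A :: "'a::field mat"
  assumes "A \<in> carrier_mat n n"
  shows "poly (char_poly A) x = det (x \<cdot>\<^sub>m 1\<^sub>m n - A)"
  unfolding char_poly_def
  by (rule poly_det_cong[of _ n]) (use assms in \<open>auto simp: char_poly_matrix_def\<close>)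

section \<open>The Cayley-Hamilton theorem\<close>

text \<open>Horner evaluation of \<open>f\<close> at \<open>A\<close>. The order is a separate
  argument because the constant term and the zero polynomial need matrices of a definite
  size.\<close>

definition poly_mat :: "nat \<Rightarrow> 'a::comm_ring_1 poly \<Rightarrow> 'a mat \<Rightarrow> 'a mat" where
  "poly_mat n f A = fold_coeffs (\<lambda>c M. c \<cdot>\<^sub>m 1\<^sub>m n + A * M) f (0\<^sub>m n n)"

lemma poly_mat_0 [simp]: "poly_mat n 0 A = 0\<^sub>m n n"
  by (simp add: poly_mat_def)

context
  fixes n :: nat and A :: "'a::comm_ring_1 mat"
  assumes A: "A \<in> carrier_mat n n"
begin

lemma poly_mat_pCons: "poly_mat n (pCons c f) A = c \<cdot>\<^sub>m 1\<^sub>m n + A * poly_mat n f A"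
  \<comment> \<open>\<open>fold_coeffs\<close> unfolds at \<open>pCons c f\<close> only if this
    polynomial is nonzero; otherwise both sides are the zero matrix.\<close>
  using A by (cases "c = 0 \<and> f = 0") (auto simp: poly_mat_def)

lemma poly_mat_carrier [simp]: "poly_mat n f A \<in> carrier_mat n n"
  by (induct f) (use A in \<open>auto simp: poly_mat_pCons\<close>)

lemma dim_poly_mat [simp]: "dim_row (poly_mat n f A) = n" "dim_col (poly_mat n f A) = n"
  by (rule carrier_matD[OF poly_mat_carrier])+

lemma poly_mat_pCons_0: "poly_mat n (pCons 0 f) A = A * poly_mat n f A"
  by (rule eq_matI) (use A in \<open>auto simp: poly_mat_pCons\<close>)

lemma poly_mat_linear: "poly_mat n [:a, b:] A = a \<cdot>\<^sub>m 1\<^sub>m n + b \<cdot>\<^sub>m A"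
proof -
  have "A * (b \<cdot>\<^sub>m 1\<^sub>m n) = b \<cdot>\<^sub>m A"
    using A by (simp add: mult_smult_distrib[of _ n n _ n])
  moreover have "b \<cdot>\<^sub>m 1\<^sub>m n + 0\<^sub>m n n = b \<cdot>\<^sub>m 1\<^sub>m n"
    by (rule eq_matI) auto
  ultimately show ?thesis using A by (simp add: poly_mat_pCons)
qed

lemma poly_mat_add: "poly_mat n (f + g) A = poly_mat n f A + poly_mat n g A"
proof (induct f g rule: poly_induct2)
  case (pCons a p b q)
  have 1: "A * (poly_mat n p A + poly_mat n q A) = A * poly_mat n p A + A * poly_mat n q A"
    by (rule mult_add_distrib_mat[OF A]) auto
  show ?case
    unfolding add_pCons poly_mat_pCons pCons 1
    by (rule eq_matI) (use A in \<open>auto simp: algebra_simps\<close>)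
qed auto

lemma poly_mat_smult: "poly_mat n (Polynomial.smult c f) A = c \<cdot>\<^sub>m poly_mat n f A"
proof (induct f)
  case (pCons a p)
  have 1: "A * (c \<cdot>\<^sub>m poly_mat n p A) = c \<cdot>\<^sub>m (A * poly_mat n p A)"
    by (rule mult_smult_distrib[OF A]) auto
  show ?case
    unfolding smult_pCons poly_mat_pCons pCons 1
    by (rule eq_matI) (use A in \<open>auto simp: algebra_simps\<close>)
qed auto

lemma poly_mat_mult: "poly_mat n (f * g) A = poly_mat n f A * poly_mat n g A"
proof (induct f)
  case 0
  then show ?case by (simp add: left_mult_zero_mat[of _ n n])
next
  case (pCons a p)
  have "poly_mat n (pCons a p * g) A
      = a \<cdot>\<^sub>m poly_mat n g A + A * (poly_mat n p A * poly_mat n g A)"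
    using A by (simp add: mult_pCons_left poly_mat_add poly_mat_smult poly_mat_pCons_0 pCons)
  also have "\<dots> = (a \<cdot>\<^sub>m 1\<^sub>m n + A * poly_mat n p A) * poly_mat n g A"
    using A by (simp add: add_mult_distrib_mat[of _ n n _ _ n] mult_smult_assoc_mat[of _ n n _ n]
        assoc_mult_mat[of _ n n _ n _ n])
  finally show ?case by (simp add: poly_mat_pCons)
qed

lemma poly_mat_power: "poly_mat n (f ^ k) A = poly_mat n f A ^\<^sub>m k"
proof (induct k)
  case 0
  show ?case using A by (auto simp: one_pCons poly_mat_pCons)
next
  case (Suc k)
  then show ?case
    by (simp only: power_Suc2 poly_mat_mult pow_mat.simps)
qed

lemma index_poly_mat_sum:
  assumes "i < n" "j < n"
  shows "poly_mat n (\<Sum>l\<in>I. f l) A $$ (i, j) = (\<Sum>l\<in>I. poly_mat n (f l) A $$ (i, j))"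
  by (induct I rule: infinite_finite_induct) (use assms in \<open>auto simp: poly_mat_add\<close>)

text \<open>Let x act on column vectors as A. For X = xI - A the unit vectors satisfy
  sum_l X(l, m) e_l = 0, so multiplying by the adjugate N of X shows that char_poly A
  annihilates every e_j.\<close>

theorem cayley_hamilton: "poly_mat n (char_poly A) A = 0\<^sub>m n n"
proof (rule eq_matI)
  fix i j assume "i < dim_row (0\<^sub>m n n :: 'a mat)" "j < dim_col (0\<^sub>m n n :: 'a mat)"
  hence ij: "i < n" "j < n" by auto
  define X where "X = char_poly_matrix A"
  define N where "N = adj_mat X"
  have X: "X \<in> carrier_mat n n" using A by (auto simp: X_def)
  have N: "N \<in> carrier_mat n n" using adj_mat(1)[OF X] by (simp add: N_def)
  have XN: "X * N = char_poly A \<cdot>\<^sub>m 1\<^sub>m n"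
    using adj_mat(2)[OF X] by (simp add: N_def X_def char_poly_def)
  have Xlm: "X $$ (l, m) = [: - A $$ (l, m), if l = m then 1 else 0 :]" if "l < n" "m < n" for l m
    using that A by (auto simp: X_def char_poly_matrix_def)
  have XNlj: "(\<Sum>m<n. X $$ (l, m) * N $$ (m, j)) = (if l = j then char_poly A else 0)"
    if "l < n" for l
    using that ij arg_cong[OF XN, of "\<lambda>M. M $$ (l, j)"]
    by (subst (asm) index_mult_mat_sum[OF X N]) auto
  define Q where "Q m = poly_mat n (N $$ (m, j)) A" for m
  have Q: "Q m \<in> carrier_mat n n" for m by (simp add: Q_def)
  have summand: "poly_mat n (X $$ (l, m) * N $$ (m, j)) A $$ (i, l)
      = (if l = m then (Q m * A) $$ (i, m) else 0) - Q m $$ (i, l) * A $$ (l, m)"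
    if "l < n" "m < n" for l m
  proof -
    have "poly_mat n (X $$ (l, m) * N $$ (m, j)) A
        = Q m * (- A $$ (l, m) \<cdot>\<^sub>m 1\<^sub>m n + (if l = m then 1 else 0) \<cdot>\<^sub>m A)"
      using that by (simp only: Xlm mult.commute[of "[:_, _:]"] poly_mat_mult poly_mat_linear Q_def)
    also have "\<dots> = - A $$ (l, m) \<cdot>\<^sub>m Q m + (if l = m then 1 else 0) \<cdot>\<^sub>m (Q m * A)"
      using A Q[of m]
      by (auto simp: mult_add_distrib_mat[of _ n n _ n] mult_smult_distrib[of _ n n _ n])
    finally show ?thesis
      using that ij Q[of m] A by (auto simp: algebra_simps simp del: index_mult_mat(1))
  qed
  \<comment> \<open>The entry is spread over a Kronecker delta in \<open>l\<close>, so that the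
    entries of \<open>X * N\<close> can replace \<open>char_poly A\<close> times the identity before
    evaluation at \<open>A\<close>.\<close>
  have "poly_mat n (char_poly A) A $$ (i, j)
      = (\<Sum>l<n. if l = j then poly_mat n (char_poly A) A $$ (i, l) else 0)"
    using ij by simp
  also have "\<dots> = (\<Sum>l<n. poly_mat n (\<Sum>m<n. X $$ (l, m) * N $$ (m, j)) A $$ (i, l))"
    using ij by (intro sum.cong) (auto simp: XNlj)
  also have "\<dots> = (\<Sum>l<n. \<Sum>m<n. (if l = m then (Q m * A) $$ (i, m) else 0)
      - Q m $$ (i, l) * A $$ (l, m))"
    using ij by (intro sum.cong) (auto simp: index_poly_mat_sum summand simp del: index_mult_mat(1))
  also have "\<dots> = (\<Sum>m<n. \<Sum>l<n. (if l = m then (Q m * A) $$ (i, m) else 0)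
      - Q m $$ (i, l) * A $$ (l, m))"
    by (rule sum.swap)
  also have "\<dots> = (\<Sum>m<n. (Q m * A) $$ (i, m) - (\<Sum>l<n. Q m $$ (i, l) * A $$ (l, m)))"
    by (intro sum.cong) (auto simp: sum_subtractf simp del: index_mult_mat(1))
  \<comment> \<open>For each \<open>m\<close> the sum over \<open>l\<close> is the expansion of the
    entry \<open>(i, m)\<close> of \<open>Q m * A\<close>, so the two terms cancel.\<close>
  also have "\<dots> = 0"
    using ij by (intro sum.neutral ballI) (simp add: index_mult_mat_sum[OF Q A] del: index_mult_mat(1))
  finally show "poly_mat n (char_poly A) A $$ (i, j) = 0\<^sub>m n n $$ (i, j)" using ij by simp
qed (auto)

end

section \<open>Determinants of bordered matrices\<close>

text \<open>The border column is fixed to ones: with corner 1 the Schur complement is then M - bJ,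
  while a = x and b = -1 give the characteristic matrix of the bordered tournament.\<close>

definition border_mat :: "'a::comm_ring_1 \<Rightarrow> 'a \<Rightarrow> 'a mat \<Rightarrow> 'a mat" where
  "border_mat a b M = four_block_mat (mat 1 1 (\<lambda>_. a)) (mat 1 (dim_col M) (\<lambda>_. b))
     (mat (dim_row M) 1 (\<lambda>_. 1)) M"

lemma border_mat_carrier:
  "M \<in> carrier_mat n n \<Longrightarrow> border_mat a b M \<in> carrier_mat (Suc n) (Suc n)"
  by (auto simp: border_mat_def)

lemma index_border_mat:
  assumes "M \<in> carrier_mat n n" "i < Suc n" "j < Suc n"
  shows "border_mat a b M $$ (i, j) =
    (if i = 0 then if j = 0 then a else b else if j = 0 then 1 else M $$ (i - 1, j - 1))"
  using assms by (auto simp: border_mat_def)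

lemma cofactor_border_mat_00:
  assumes M: "M \<in> carrier_mat n n"
  shows "cofactor (border_mat a b M) 0 0 = det M"
proof -
  have "mat_delete (border_mat a b M) 0 0 = M"
    using M border_mat_carrier[OF M, of a b]
    by (intro eq_matI) (auto simp: mat_delete_def index_border_mat[OF M])
  thus ?thesis by (simp add: cofactor_def)
qed

text \<open>The cofactors along row 0 do not see that row, so they are independent of
  \<open>a\<close> and \<open>b\<close>, and a single \<theta> serves all borders.\<close>

lemma det_border_mat:
  assumes M: "M \<in> carrier_mat n n"
  obtains \<theta> where "\<And>a b. det (border_mat a b M) = a * det M + b * \<theta>"
proof
  define \<theta> where "\<theta> = (\<Sum>j<n. cofactor (border_mat 0 0 M) 0 (Suc j))"
  fix a b
  have "cofactor (border_mat a b M) 0 j = cofactor (border_mat 0 0 M) 0 j" if "j < Suc n" for j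
  proof -
    have "mat_delete (border_mat a b M) 0 j = mat_delete (border_mat 0 0 M) 0 j"
      using M that border_mat_carrier[OF M, of a b] border_mat_carrier[OF M, of 0 0]
      by (intro eq_matI) (auto simp: mat_delete_def index_border_mat[OF M])
    thus ?thesis by (simp add: cofactor_def)
  qed
  moreover have "det (border_mat a b M)
      = (\<Sum>j<Suc n. border_mat a b M $$ (0, j) * cofactor (border_mat a b M) 0 j)"
    by (rule laplace_expansion_row[OF border_mat_carrier[OF M]]) simp
  moreover have "\<dots> = a * det M + (\<Sum>j<n. b * cofactor (border_mat a b M) 0 (Suc j))"
    by (simp only: sum.lessThan_Suc_shift)
      (auto simp: index_border_mat[OF M] cofactor_border_mat_00[OF M] intro!: sum.cong)
  ultimately show "det (border_mat a b M) = a * det M + b * \<theta>"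
    by (simp add: sum_distrib_left \<theta>_def)
qed

text \<open>Block LU factorisation with pivot 1: the lower factor has determinant 1, and the upper
  one carries the Schur complement.\<close>

lemma det_border_mat_1:
  fixes M :: "'a::idom mat"
  assumes M: "M \<in> carrier_mat n n"
  shows "det (border_mat 1 b M) = det (M - b \<cdot>\<^sub>m mat n n (\<lambda>_. 1))"
proof -
  let ?M' = "M - b \<cdot>\<^sub>m mat n n (\<lambda>_. 1)"
  let ?L = "four_block_mat (1\<^sub>m 1) (0\<^sub>m 1 n) (mat n 1 (\<lambda>_. 1)) (1\<^sub>m n) :: 'a mat"
  let ?U = "four_block_mat (1\<^sub>m 1) (mat 1 n (\<lambda>_. b)) (0\<^sub>m n 1) ?M'"
  have "?L * ?U = border_mat 1 b M"
    using M by (subst mult_four_block_mat[of _ 1 1 _ n _ n _ _ 1 _ n])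
      (auto simp: border_mat_def scalar_prod_def intro!: eq_matI)
  moreover have "det ?L = 1"
    by (subst det_four_block_mat_upper_right_zero[of _ 1 _ n]) auto
  moreover have "det ?U = det ?M'"
    using M by (subst det_four_block_mat_lower_left_zero[of _ 1 _ n]) auto
  moreover have "?L \<in> carrier_mat (1 + n) (1 + n)" "?U \<in> carrier_mat (1 + n) (1 + n)"
    using M by (auto intro!: four_block_carrier_mat)
  ultimately show ?thesis
    by (metis det_mult mult_1)
qed

text \<open>At a = 1 the linear formula for bordered determinants meets the Schur complement, so the
  same \<theta> governs adding multiples of J and bordering.\<close>

lemma det_minus_all_ones_affine:
  fixes M :: "'a::idom mat"
  assumes M: "M \<in> carrier_mat n n"
  obtains \<theta> where "\<And>b. det (M - b \<cdot>\<^sub>m mat n n (\<lambda>_. 1)) = det M + b * \<theta>"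
    "\<And>a b. det (border_mat a b M) = a * det M + b * \<theta>"
  using det_border_mat[OF M] det_border_mat_1[OF M] by (metis mult_1)

text \<open>The determinant of qI - bJ is affine in b, so two values fix it: b = 0 gives q^m, and b
  = q/m gives zero because the all-ones vector is then in the kernel.\<close>

lemma det_scalar_plus_all_ones:
  fixes q :: real
  assumes q: "q \<noteq> 0" and m: "m > 0"
  shows "det (q \<cdot>\<^sub>m 1\<^sub>m m + 2 \<cdot>\<^sub>m all_ones_mat m) = q ^ (m - 1) * (q + 2 * real m)"
proof -
  have M: "q \<cdot>\<^sub>m 1\<^sub>m m \<in> carrier_mat m m" by auto
  obtain \<theta> where \<theta>: "\<And>b. det (q \<cdot>\<^sub>m 1\<^sub>m m - b \<cdot>\<^sub>m mat m m (\<lambda>_. 1)) = det (q \<cdot>\<^sub>m 1\<^sub>m m) + b * \<theta>"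
    using det_minus_all_ones_affine[OF M] by metis
  let ?Z = "q \<cdot>\<^sub>m 1\<^sub>m m - (q / real m) \<cdot>\<^sub>m mat m m (\<lambda>_. 1)"
  have Z: "?Z \<in> carrier_mat m m" by auto
  have "det ?Z = 0"
    unfolding det_0_iff_vec_prod_zero[OF Z]
  proof (intro exI conjI)
    show "vec m (\<lambda>_. 1) \<noteq> (0\<^sub>v m :: real vec)" using m
      by (metis index_vec index_zero_vec(1) zero_neq_one)
    show "?Z *\<^sub>v vec m (\<lambda>_. 1) = 0\<^sub>v m"
      using m by (intro eq_vecI) (auto simp: scalar_prod_def sum_subtractf if_distrib[of "(*) _"] sum.delta cong: if_cong)
  qed auto
  hence "q ^ m + q / real m * \<theta> = 0" using \<theta>[of "q / real m"] by simp
  hence t: "\<theta> = - real m * q ^ (m - 1)"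
  proof -
    have "q ^ m = q * q ^ (m - 1)" using m by (cases m) auto
    with \<open>q ^ m + q / real m * \<theta> = 0\<close> have "q * (real m * q ^ (m - 1) + \<theta>) = 0"
      using m by (simp add: field_simps)
    thus ?thesis using q by simp
  qed
  have "q \<cdot>\<^sub>m 1\<^sub>m m + 2 \<cdot>\<^sub>m all_ones_mat m = q \<cdot>\<^sub>m 1\<^sub>m m - (-2) \<cdot>\<^sub>m mat m m (\<lambda>_. 1)"
    by (rule eq_matI) (auto simp: all_ones_mat_def)
  thus ?thesis using \<theta>[of "-2"] t m by (cases m) (auto simp: algebra_simps)
qed

section \<open>Bordered tournament matrices\<close>

text \<open>The matrix S of the overview. Every skew sign matrix with zero diagonal can be switched
  into this form, with ones in row 0 off the diagonal.\<close>

definition seidel_mat :: "nat \<Rightarrow> real mat \<Rightarrow> real mat" where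
  "seidel_mat n A = mat (Suc n) (Suc n) (\<lambda>(i, j).
     if i = 0 then if j = 0 then 0 else 1
     else if j = 0 then -1 else A $$ (i - 1, j - 1) - A $$ (j - 1, i - 1))"

lemma seidel_mat_carrier [simp]: "seidel_mat n A \<in> carrier_mat (Suc n) (Suc n)"
  by (simp add: seidel_mat_def)

lemma tournament_matrix_entries:
  assumes "tournament_matrix n A" "i < n" "j < n"
  shows "A $$ (i, j) \<in> {0, 1}" "A $$ (i, j) + A $$ (j, i) = (if i = j then 0 else 1)"
proof -
  have A: "A \<in> carrier_mat n n" and e: "A + transpose_mat A = all_ones_mat n - 1\<^sub>m n"
    using assms(1) by (auto simp: tournament_matrix_def)
  show "A $$ (i, j) \<in> {0, 1}" using assms by (auto simp: tournament_matrix_def)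
  show "A $$ (i, j) + A $$ (j, i) = (if i = j then 0 else 1)"
    using arg_cong[OF e, of "\<lambda>M. M $$ (i, j)"] assms A by (auto simp: all_ones_mat_def)
qed

lemma border_mat_seidel:
  assumes "A \<in> carrier_mat n n"
  shows "x \<cdot>\<^sub>m 1\<^sub>m (Suc n) - seidel_mat n A
    = border_mat x (-1) (x \<cdot>\<^sub>m 1\<^sub>m n - (A - transpose_mat A))"
proof (rule eq_matI)
  have M: "x \<cdot>\<^sub>m 1\<^sub>m n - (A - transpose_mat A) \<in> carrier_mat n n" using assms by auto
  show "dim_row (x \<cdot>\<^sub>m 1\<^sub>m (Suc n) - seidel_mat n A)
      = dim_row (border_mat x (-1) (x \<cdot>\<^sub>m 1\<^sub>m n - (A - transpose_mat A)))"
    "dim_col (x \<cdot>\<^sub>m 1\<^sub>m (Suc n) - seidel_mat n A)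
      = dim_col (border_mat x (-1) (x \<cdot>\<^sub>m 1\<^sub>m n - (A - transpose_mat A)))"
    using border_mat_carrier[OF M, of x "-1"] by (auto simp: seidel_mat_def)
  fix i j
  assume "i < dim_row (border_mat x (-1) (x \<cdot>\<^sub>m 1\<^sub>m n - (A - transpose_mat A)))"
    "j < dim_col (border_mat x (-1) (x \<cdot>\<^sub>m 1\<^sub>m n - (A - transpose_mat A)))"
  hence "i < Suc n" "j < Suc n" using border_mat_carrier[OF M, of x "-1"] by auto
  thus "(x \<cdot>\<^sub>m 1\<^sub>m (Suc n) - seidel_mat n A) $$ (i, j)
      = border_mat x (-1) (x \<cdot>\<^sub>m 1\<^sub>m n - (A - transpose_mat A)) $$ (i, j)"
    using assms by (cases i; cases j) (auto simp: index_border_mat[OF M] seidel_mat_def)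
qed

lemma tournament_seidel_dets:
  assumes T: "tournament_matrix n A" and n: "odd n"
  obtains D \<theta> where
    "D = cofactor (x \<cdot>\<^sub>m 1\<^sub>m (Suc n) - seidel_mat n A) 0 0"
    "poly (char_poly (seidel_mat n A)) x = x * D - \<theta>"
    "2 ^ n * poly (char_poly A) ((x - 1) / 2) = D + \<theta>"
    "2 ^ n * poly (char_poly A) ((- x - 1) / 2) = \<theta> - D"
proof -
  have A: "A \<in> carrier_mat n n" using T by (simp add: tournament_matrix_def)
  define M where "M = x \<cdot>\<^sub>m 1\<^sub>m n - (A - transpose_mat A)"
  have M: "M \<in> carrier_mat n n" using A by (auto simp: M_def)
  obtain \<theta> where \<theta>: "\<And>b. det (M - b \<cdot>\<^sub>m mat n n (\<lambda>_. 1)) = det M + b * \<theta>"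
    "\<And>a b. det (border_mat a b M) = a * det M + b * \<theta>"
    using det_minus_all_ones_affine[OF M] by metis
  note S = border_mat_seidel[OF A, of x, folded M_def]
  have 1: "M - 1 \<cdot>\<^sub>m mat n n (\<lambda>_. 1) = 2 \<cdot>\<^sub>m (((x - 1) / 2) \<cdot>\<^sub>m 1\<^sub>m n - A)" (is "?L = ?R")
  \<comment> \<open>The tournament identity gives K + J = 2A + I for K = A - A^T.\<close>
  proof (rule eq_matI)
    fix i j assume "i < dim_row ?R" "j < dim_col ?R"
    with A have "i < n" "j < n" by auto
    thus "?L $$ (i, j) = ?R $$ (i, j)"
      using A tournament_matrix_entries(2)[OF T, of i j]
      by (cases "i = j") (simp_all add: M_def field_simps)
  qed (use A in auto)
  have 2: "M - (-1) \<cdot>\<^sub>m mat n n (\<lambda>_. 1)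
      = (-2) \<cdot>\<^sub>m (((- x - 1) / 2) \<cdot>\<^sub>m 1\<^sub>m n - transpose_mat A)" (is "?L = ?R")
  \<comment> \<open>Likewise K - J = -(2A^T + I); the transpose is harmless for the characteristic
    polynomial.\<close>
  proof (rule eq_matI)
    fix i j assume "i < dim_row ?R" "j < dim_col ?R"
    with A have "i < n" "j < n" by auto
    thus "?L $$ (i, j) = ?R $$ (i, j)"
      using A tournament_matrix_entries(2)[OF T, of i j]
      by (cases "i = j") (simp_all add: M_def field_simps)
  qed (use A in auto)
  have tA: "transpose_mat A \<in> carrier_mat n n" using A by simp
  show ?thesis
  proof (rule that[of "det M" \<theta>])
    show "det M = cofactor (x \<cdot>\<^sub>m 1\<^sub>m (Suc n) - seidel_mat n A) 0 0"
      by (simp add: S cofactor_border_mat_00[OF M])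
    show "poly (char_poly (seidel_mat n A)) x = x * det M - \<theta>"
      by (simp add: poly_char_poly[of _ "Suc n"] S \<theta>(2))
    show "2 ^ n * poly (char_poly A) ((x - 1) / 2) = det M + \<theta>"
      using A \<theta>(1)[of 1] unfolding 1 by (simp add: poly_char_poly[OF A])
    have "det M - \<theta> = (-2) ^ n * det (((- x - 1) / 2) \<cdot>\<^sub>m 1\<^sub>m n - transpose_mat A)"
      using A \<theta>(1)[of "-1"] by (simp add: 2)
    \<comment> \<open>Oddness of the order turns the factor (-2)^n into -2^n.\<close>
    also have "\<dots> = - (2 ^ n * poly (char_poly A) ((- x - 1) / 2))"
      using n by (simp add: poly_char_poly[OF tA, symmetric] char_poly_transpose_mat[OF A])
    finally show "2 ^ n * poly (char_poly A) ((- x - 1) / 2) = \<theta> - det M" by simp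
  qed
qed

section \<open>The two characteristic polynomials and the passage from A to S\<close>

definition tournament_poly :: "nat \<Rightarrow> real poly" where
  "tournament_poly t =
     (monom 1 3 - monom (2 * real t - 1) 2 - [:real t * (4 * real t - 1):]) *
     (monom 1 2 + monom 1 1 + [:real t:]) ^ (2 * t - 1)"

text \<open>The power of two splits into 8 for the cubic and 4 for each of the 2t - 1 quadratic
  factors, which clears all denominators.\<close>

lemma poly_tournament_poly:
  assumes "t > 0"
  shows "2 ^ (4 * t + 1) * poly (tournament_poly t) ((x - 1) / 2) =
    (x ^ 3 - (4 * real t + 1) * x\<^sup>2 + (8 * real t - 1) * x - (4 * real t - 1) * (8 * real t + 1))
    * (x\<^sup>2 + (4 * real t - 1)) ^ (2 * t - 1)"
proof -
  define p where "p = ((x - 1) / 2)\<^sup>2 + (x - 1) / 2 + real t"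
  have p: "4 * p = x\<^sup>2 + (4 * real t - 1)"
    by (simp add: p_def power2_eq_square field_simps)
  have "(2::real) ^ (4 * t + 1) = 8 * 4 ^ (2 * t - 1)"
  proof -
    have "4 * t + 1 = 3 + 2 * (2 * t - 1)" using assms by simp
    thus ?thesis by (simp only: power_add power_mult) simp
  qed
  moreover have "poly (tournament_poly t) ((x - 1) / 2) =
      (((x - 1) / 2) ^ 3 - (2 * real t - 1) * ((x - 1) / 2)\<^sup>2 - real t * (4 * real t - 1)) * p ^ (2 * t - 1)"
    by (simp add: tournament_poly_def p_def poly_monom)
  ultimately have "2 ^ (4 * t + 1) * poly (tournament_poly t) ((x - 1) / 2) =
      (8 * (((x - 1) / 2) ^ 3 - (2 * real t - 1) * ((x - 1) / 2)\<^sup>2 - real t * (4 * real t - 1)))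
        * (4 * p) ^ (2 * t - 1)"
    by (simp only: power_mult_distrib mult_ac)
  also have "8 * (((x - 1) / 2) ^ 3 - (2 * real t - 1) * ((x - 1) / 2)\<^sup>2 - real t * (4 * real t - 1))
      = x ^ 3 - (4 * real t + 1) * x\<^sup>2 + (8 * real t - 1) * x - (4 * real t - 1) * (8 * real t + 1)"
    by (simp add: power2_eq_square power3_eq_cube field_simps)
  finally show ?thesis by (simp only: p)
qed

lemma degree_tournament_poly:
  assumes "t > 0"
  shows "degree (tournament_poly t) = 4 * t + 1"
proof -
  have 1: "monom 1 3 - monom (2 * real t - 1) 2 - [:real t * (4 * real t - 1):]
      = [: - (real t * (4 * real t - 1)), 0, - (2 * real t - 1), 1 :]"
    by (simp add: monom_altdef numeral_eq_Suc)
  have 2: "monom 1 2 + monom 1 1 + [:real t:] = [: real t, 1, 1 :]"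
    by (simp add: monom_altdef numeral_eq_Suc)
  show ?thesis
    unfolding tournament_poly_def 1 2 using assms
    by (subst degree_mult_eq) (auto simp: degree_power_eq)
qed

text \<open>The constants are the Gram eigenvalues of an EW matrix minus one: 4t, of multiplicity
  4t, and 8t + 2, of multiplicity 2.\<close>

definition seidel_poly :: "nat \<Rightarrow> real poly" where
  "seidel_poly t = [: 4 * real t - 1, 0, 1 :] ^ (2 * t) * [: 8 * real t + 1, 0, 1 :]"

lemma poly_seidel_poly:
  "poly (seidel_poly t) x = (x\<^sup>2 + (4 * real t - 1)) ^ (2 * t) * (x\<^sup>2 + (8 * real t + 1))"
  by (simp add: seidel_poly_def power2_eq_square algebra_simps)

lemma char_poly_seidel_mat:
  assumes T: "tournament_matrix (4 * t + 1) A" and t: "t > 0"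
    and f: "char_poly A = tournament_poly t"
  shows "char_poly (seidel_mat (4 * t + 1) A) = seidel_poly t"
proof -
  have "poly (char_poly (seidel_mat (4 * t + 1) A)) x = poly (seidel_poly t) x" for x
  proof -
    have "odd (4 * t + 1)" by simp
    from tournament_seidel_dets[OF T this, of x] obtain D \<theta> where *:
      "poly (char_poly (seidel_mat (4 * t + 1) A)) x = x * D - \<theta>"
      "2 ^ (4 * t + 1) * poly (char_poly A) ((x - 1) / 2) = D + \<theta>"
      "2 ^ (4 * t + 1) * poly (char_poly A) ((- x - 1) / 2) = \<theta> - D" by metis
    define q where "q = (x\<^sup>2 + (4 * real t - 1)) ^ (2 * t - 1)"
    have q: "(x\<^sup>2 + (4 * real t - 1)) ^ (2 * t) = (x\<^sup>2 + (4 * real t - 1)) * q"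
      using t by (simp add: q_def flip: power_Suc)
    have 1: "D + \<theta> = (x ^ 3 - (4 * real t + 1) * x\<^sup>2 + (8 * real t - 1) * x - (4 * real t - 1) * (8 * real t + 1)) * q"
      using *(2) unfolding f poly_tournament_poly[OF t] q_def by simp
    have 2: "\<theta> - D = (- (x ^ 3) - (4 * real t + 1) * x\<^sup>2 - (8 * real t - 1) * x - (4 * real t - 1) * (8 * real t + 1)) * q"
      using *(3) unfolding f poly_tournament_poly[OF t] q_def by simp
    \<comment> \<open>The values at x and -x separate the two unknowns: D is the odd and \<theta>
      the even part in x.\<close>
    have D: "D = (x ^ 3 + (8 * real t - 1) * x) * q"
      using 1 2 by (simp add: algebra_simps)
    have \<theta>: "\<theta> = (- (4 * real t + 1) * x\<^sup>2 - (4 * real t - 1) * (8 * real t + 1)) * q"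
      using 1 2 by (simp add: algebra_simps)
    show ?thesis
      unfolding *(1) D \<theta> poly_seidel_poly q
      by (simp add: algebra_simps power2_eq_square power3_eq_cube)
  qed
  thus ?thesis by (simp add: poly_eq_poly_eq_iff[symmetric] fun_eq_iff)
qed

section \<open>The resolvent of S and the passage from S to A\<close>

lemma char_matrix_mult_conj:
  fixes S :: "'a::comm_ring_1 mat"
  assumes S: "S \<in> carrier_mat N N"
  shows "(x \<cdot>\<^sub>m 1\<^sub>m N - S) * (x \<cdot>\<^sub>m 1\<^sub>m N + S) = x\<^sup>2 \<cdot>\<^sub>m 1\<^sub>m N - S * S"
proof -
  define X where "X = x \<cdot>\<^sub>m 1\<^sub>m N - S"
  have X: "X \<in> carrier_mat N N" using S by (auto simp: X_def)
  have "X * (x \<cdot>\<^sub>m 1\<^sub>m N + S) = X * (x \<cdot>\<^sub>m 1\<^sub>m N) + X * S"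
    using S X by (simp add: mult_add_distrib_mat[of _ N N _ N])
  also have "X * (x \<cdot>\<^sub>m 1\<^sub>m N) = x \<cdot>\<^sub>m X"
    using X by (simp add: mult_smult_distrib[of _ N N _ N])
  also have "X * S = x \<cdot>\<^sub>m S - S * S"
    using S by (simp add: X_def minus_mult_distrib_mat[of _ N N _ _ N]
        mult_smult_assoc_mat[of _ N N _ N])
  finally show ?thesis
    using S by (auto simp: X_def power2_eq_square algebra_simps simp del: index_mult_mat(1)
      intro!: eq_matI)
qed

text \<open>The quadratic relation for S * S makes the resolvent explicit: the inverse of xI - S is
  (xI + S)(S * S + (x * x + 12t)I) divided by (x * x + 4t - 1)(x * x + 8t + 1). Its part that is odd
  in S is skew, hence does not contribute to the diagonal.\<close>

lemma cofactor_resolvent_skew: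
  fixes S :: "real mat"
  assumes S: "S \<in> carrier_mat N N" and N: "N > 0" and skew: "transpose_mat S = - S"
    and t: "t > 0"
    and W: "S * S * (S * S) = - (12 * real t) \<cdot>\<^sub>m (S * S)
      - ((4 * real t - 1) * (8 * real t + 1)) \<cdot>\<^sub>m 1\<^sub>m N"
    and W00: "(S * S) $$ (0, 0) = - (4 * real t + 1)"
    and det: "det (x \<cdot>\<^sub>m 1\<^sub>m N - S) = (x\<^sup>2 + (4 * real t - 1)) ^ (2 * t) * (x\<^sup>2 + (8 * real t + 1))"
  shows "cofactor (x \<cdot>\<^sub>m 1\<^sub>m N - S) 0 0
    = (x\<^sup>2 + (4 * real t - 1)) ^ (2 * t - 1) * (x * (x\<^sup>2 + (8 * real t - 1)))"
proof -
  define X where "X = x \<cdot>\<^sub>m 1\<^sub>m N - S"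
  define V where "V = S * S"
  \<comment> \<open>With f(y) = (y + 4t - 1)(y + 8t + 1), so that f(V) = 0, this is the quotient of
    f(x^2) - f(V) by x^2 - V. Hence (x^2 I - V) Z = f(x^2) I, and f(x^2) = q r.\<close>
  define Z where "Z = V + (x\<^sup>2 + 12 * real t) \<cdot>\<^sub>m 1\<^sub>m N"
  define Y where "Y = (x \<cdot>\<^sub>m 1\<^sub>m N + S) * Z"
  define q where "q = x\<^sup>2 + (4 * real t - 1)"
  define r where "r = x\<^sup>2 + (8 * real t + 1)"
  have c: "X \<in> carrier_mat N N" "V \<in> carrier_mat N N" "Z \<in> carrier_mat N N" "Y \<in> carrier_mat N N"
    using S by (auto simp: X_def V_def Z_def Y_def)
  have t1: "real t \<ge> 1" using t by simp
  \<comment> \<open>Since t is at least 1, both factors are positive at every real x and can be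
    cancelled at the end.\<close>
  have "q > 0" "r > 0" using t1 by (auto simp: q_def r_def intro: add_nonneg_pos)
  have XS: "X * (x \<cdot>\<^sub>m 1\<^sub>m N + S) = x\<^sup>2 \<cdot>\<^sub>m 1\<^sub>m N - V"
    using char_matrix_mult_conj[OF S] by (simp add: X_def V_def)
  have VV: "V * V = - (12 * real t) \<cdot>\<^sub>m V - ((4 * real t - 1) * (8 * real t + 1)) \<cdot>\<^sub>m 1\<^sub>m N"
    using W by (simp add: V_def)
  have "(x\<^sup>2 \<cdot>\<^sub>m 1\<^sub>m N - V) * Z = x\<^sup>2 \<cdot>\<^sub>m Z - (V * V + (x\<^sup>2 + 12 * real t) \<cdot>\<^sub>m V)"
  proof -
    have "(x\<^sup>2 \<cdot>\<^sub>m 1\<^sub>m N - V) * Z = x\<^sup>2 \<cdot>\<^sub>m Z - V * Z"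
      using c by (simp add: minus_mult_distrib_mat[of _ N N _ _ N]
          mult_smult_assoc_mat[of _ N N _ N])
    also have "V * Z = V * V + (x\<^sup>2 + 12 * real t) \<cdot>\<^sub>m V"
      using c by (simp add: Z_def mult_add_distrib_mat[of _ N N _ N]
          mult_smult_distrib[of _ N N _ N])
    finally show ?thesis .
  qed
  also have "\<dots> = (q * r) \<cdot>\<^sub>m 1\<^sub>m N"
    unfolding VV using c by (auto simp: Z_def q_def r_def power2_eq_square algebra_simps
        intro!: eq_matI)
  finally have XY: "X * Y = (q * r) \<cdot>\<^sub>m 1\<^sub>m N"
    using c S by (simp add: Y_def XS[symmetric] assoc_mult_mat[of _ N N _ N _ N])
  have adj: "adj_mat X \<in> carrier_mat N N" using adj_mat(1)[OF c(1)] .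
  \<comment> \<open>Multiplying X Y = q r I by the adjugate brings in the cofactor without inverting
    X.\<close>
  have "det X \<cdot>\<^sub>m Y = adj_mat X * X * Y"
    using c by (simp add: adj_mat(3)[OF c(1)] mult_smult_assoc_mat[of _ N N _ N])
  also have "\<dots> = (q * r) \<cdot>\<^sub>m adj_mat X"
    using c adj by (simp add: assoc_mult_mat[of _ N N _ N _ N] XY mult_smult_distrib[of _ N N _ N])
  finally have "(det X \<cdot>\<^sub>m Y) $$ (0, 0) = ((q * r) \<cdot>\<^sub>m adj_mat X) $$ (0, 0)" by simp
  hence main: "det X * Y $$ (0, 0) = q * r * cofactor X 0 0"
    using N c adj by (simp add: adj_mat_def)
  have SV: "(S * V) $$ (0, 0) = 0"
  proof -
    have tV: "transpose_mat V = V"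
      unfolding V_def using S skew by (simp add: transpose_mult[of _ N N _ N])
    have "transpose_mat (S * V) = - (S * V)"
    proof -
      have "transpose_mat (S * V) = V * (- S)"
        using S c skew tV by (simp add: transpose_mult[of _ N N _ N])
      also have "\<dots> = - (S * V)"
        using S c by (simp add: V_def assoc_mult_mat[of _ N N _ N _ N])
      finally show ?thesis .
    qed
    hence "transpose_mat (S * V) $$ (0, 0) = (- (S * V)) $$ (0, 0)" by simp
    thus ?thesis using S c N by (simp del: index_mult_mat(1))
  qed
  have "Y = x \<cdot>\<^sub>m Z + (S * V + (x\<^sup>2 + 12 * real t) \<cdot>\<^sub>m S)"
    using c S unfolding Y_def
    by (simp add: add_mult_distrib_mat[of _ N N _ _ N] mult_smult_assoc_mat[of _ N N _ N])
      (simp add: Z_def mult_add_distrib_mat[of _ N N _ N] mult_smult_distrib[of _ N N _ N])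
  moreover have "S $$ (0, 0) = 0"
    using arg_cong[OF skew, of "\<lambda>M. M $$ (0, 0)"] S N by simp
  ultimately have Y00: "Y $$ (0, 0) = x * (x\<^sup>2 + (8 * real t - 1))"
    using c S N SV W00 by (simp add: Z_def V_def del: index_mult_mat(1))
  have "q ^ (2 * t) = q * q ^ (2 * t - 1)" using t by (simp flip: power_Suc)
  moreover have "det X = q ^ (2 * t) * r" using det by (simp add: X_def q_def r_def)
  ultimately have dX: "det X = q * q ^ (2 * t - 1) * r" by simp
  have "q * r * cofactor X 0 0 = q * r * (q ^ (2 * t - 1) * (x * (x\<^sup>2 + (8 * real t - 1))))"
    using main dX Y00 by (simp only: mult_ac)
  thus ?thesis using \<open>q > 0\<close> \<open>r > 0\<close> by (simp add: X_def q_def[symmetric])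
qed

text \<open>The cofactor is D = det(xI - K), the characteristic polynomial of S then yields
  \<theta>, and D + \<theta> is the scaled value of \<open>char_poly A\<close> at (x - 1)/2.\<close>

lemma char_poly_tournament:
  assumes T: "tournament_matrix (4 * t + 1) A" and t: "t > 0"
    and cp: "char_poly (seidel_mat (4 * t + 1) A) = seidel_poly t"
    and cof: "\<And>x. cofactor (x \<cdot>\<^sub>m 1\<^sub>m (Suc (4 * t + 1)) - seidel_mat (4 * t + 1) A) 0 0
      = (x\<^sup>2 + (4 * real t - 1)) ^ (2 * t - 1) * (x * (x\<^sup>2 + (8 * real t - 1)))"
  shows "char_poly A = tournament_poly t"
proof -
  have "poly (char_poly A) y = poly (tournament_poly t) y" for y
  proof -
    define x where "x = 2 * y + 1"
    have y: "y = (x - 1) / 2" by (simp add: x_def)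
    have "odd (4 * t + 1)" by simp
    from tournament_seidel_dets[OF T this, of x] obtain D \<theta> where *:
      "D = cofactor (x \<cdot>\<^sub>m 1\<^sub>m (Suc (4 * t + 1)) - seidel_mat (4 * t + 1) A) 0 0"
      "poly (char_poly (seidel_mat (4 * t + 1) A)) x = x * D - \<theta>"
      "2 ^ (4 * t + 1) * poly (char_poly A) ((x - 1) / 2) = D + \<theta>" by metis
    define q where "q = (x\<^sup>2 + (4 * real t - 1)) ^ (2 * t - 1)"
    have q: "(x\<^sup>2 + (4 * real t - 1)) ^ (2 * t) = (x\<^sup>2 + (4 * real t - 1)) * q"
      using t by (simp add: q_def flip: power_Suc)
    have D: "D = q * (x * (x\<^sup>2 + (8 * real t - 1)))" using *(1) cof by (simp add: q_def)
    have "\<theta> = x * D - (x\<^sup>2 + (4 * real t - 1)) * q * (x\<^sup>2 + (8 * real t + 1))"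
      using *(2) unfolding cp poly_seidel_poly q by simp
    hence "2 ^ (4 * t + 1) * poly (char_poly A) ((x - 1) / 2)
        = 2 ^ (4 * t + 1) * poly (tournament_poly t) ((x - 1) / 2)"
      unfolding *(3) D poly_tournament_poly[OF t] q_def[symmetric]
      by (simp add: algebra_simps power2_eq_square power3_eq_cube)
    thus ?thesis unfolding y by simp
  qed
  thus ?thesis by (simp add: poly_eq_poly_eq_iff[symmetric] fun_eq_iff)
qed

section \<open>From skew EW matrices to tournaments\<close>

text \<open>xI + S is the transpose of xI - S, so both have the same determinant, and their product
  involves only S * S.\<close>

lemma det_skew_sq:
  fixes S :: "'a::comm_ring_1 mat"
  assumes S: "S \<in> carrier_mat N N" and skew: "transpose_mat S = - S"
  shows "(det (x \<cdot>\<^sub>m 1\<^sub>m N - S))\<^sup>2 = det (x\<^sup>2 \<cdot>\<^sub>m 1\<^sub>m N - S * S)"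
proof -
  have sk: "S $$ (j, i) = - S $$ (i, j)" if "i < N" "j < N" for i j
    using arg_cong[OF skew, of "\<lambda>M. M $$ (i, j)"] that S by simp
  have c: "x \<cdot>\<^sub>m 1\<^sub>m N - S \<in> carrier_mat N N" "x \<cdot>\<^sub>m 1\<^sub>m N + S \<in> carrier_mat N N"
    using S by auto
  have "x \<cdot>\<^sub>m 1\<^sub>m N + S = transpose_mat (x \<cdot>\<^sub>m 1\<^sub>m N - S)"
  proof (rule eq_matI)
    fix i j assume "i < dim_row (transpose_mat (x \<cdot>\<^sub>m 1\<^sub>m N - S))"
      "j < dim_col (transpose_mat (x \<cdot>\<^sub>m 1\<^sub>m N - S))"
    hence "i < N" "j < N" using S by auto
    thus "(x \<cdot>\<^sub>m 1\<^sub>m N + S) $$ (i, j) = transpose_mat (x \<cdot>\<^sub>m 1\<^sub>m N - S) $$ (i, j)"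
      using S sk[of i j] by auto
  qed (use S in auto)
  hence "det (x \<cdot>\<^sub>m 1\<^sub>m N + S) = det (x \<cdot>\<^sub>m 1\<^sub>m N - S)" using det_transpose[OF c(1)] by simp
  thus ?thesis
    using det_mult[OF c] by (simp add: char_matrix_mult_conj[OF S] power2_eq_square)
qed

section \<open>The Gram matrix of an EW matrix, entrywise\<close>

definition same_half :: "nat \<Rightarrow> nat \<Rightarrow> nat \<Rightarrow> bool" where
  "same_half m i j \<longleftrightarrow> (i < m \<longleftrightarrow> j < m)"

text \<open>The indicator is a direct sum H of two all-ones blocks of order m, and H * H = m
  H.\<close>

lemma sum_same_half:
  assumes "i < 2 * m" "j < 2 * m"
  shows "(\<Sum>k<2 * m. of_bool (same_half m i k) * of_bool (same_half m k j) :: real)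
    = real m * of_bool (same_half m i j)"
proof -
  have "{k. k < 2 * m \<and> k < m} = {..<m}" "{k. k < 2 * m \<and> \<not> k < m} = {m..<2 * m}" by auto
  hence "card {k. k < 2 * m \<and> same_half m i k} = m"
    by (cases "i < m") (auto simp: same_half_def)
  moreover have "(\<Sum>k<2 * m. of_bool (same_half m i k) * of_bool (same_half m k j) :: real)
      = (\<Sum>k<2 * m. if same_half m i k then of_bool (same_half m i j) else 0)"
    by (intro sum.cong) (auto simp: same_half_def)
  moreover have "\<dots> = real (card {k. k < 2 * m \<and> same_half m i k}) * of_bool (same_half m i j)"
    by (subst sum.inter_filter[symmetric]) (auto simp: lessThan_def)
  ultimately show ?thesis by simp
qed

definition EW_gram :: "nat \<Rightarrow> real mat" where
  "EW_gram t = mat (4 * t + 2) (4 * t + 2)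
     (\<lambda>(i, j). 4 * real t * of_bool (i = j) + 2 * of_bool (same_half (2 * t + 1) i j))"

lemma EW_gram_four_block:
  "four_block_mat (EW_block (4 * t + 2)) (0\<^sub>m ((4 * t + 2) div 2) ((4 * t + 2) div 2))
    (0\<^sub>m ((4 * t + 2) div 2) ((4 * t + 2) div 2)) (EW_block (4 * t + 2)) = EW_gram t"
proof -
  have "(4 * t + 2) div 2 = 2 * t + 1" by simp
  thus ?thesis
    by (intro eq_matI) (auto simp: EW_gram_def EW_block_def all_ones_mat_def same_half_def)
qed

lemma EW_matrix_iff_gram:
  "EW_matrix (4 * t + 2) B \<longleftrightarrow> pm1_matrix (4 * t + 2) B \<and>
     B * transpose_mat B = EW_gram t \<and> transpose_mat B * B = EW_gram t"
  unfolding EW_matrix_def EW_gram_four_block by auto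

lemma diag_conj_mat:
  fixes M :: "'a::comm_ring_1 mat" and d :: "nat \<Rightarrow> 'a"
  assumes M: "M \<in> carrier_mat N N" and ij: "i < N" "j < N"
  defines "D \<equiv> mat N N (\<lambda>(i, j). if i = j then d i else 0)"
  shows "(D * M * D) $$ (i, j) = d i * d j * M $$ (i, j)"
proof -
  have D: "D \<in> carrier_mat N N" by (simp add: D_def)
  have "(D * M) $$ (i, k) = d i * M $$ (i, k)" if "k < N" for k
  proof -
    have "(D * M) $$ (i, k) = (\<Sum>l<N. D $$ (i, l) * M $$ (l, k))"
      by (rule index_mult_mat_sum[OF D M]) (use ij that in auto)
    also have "\<dots> = (\<Sum>l<N. if i = l then d i * M $$ (i, k) else 0)"
      using ij by (intro sum.cong) (auto simp: D_def)
    finally show ?thesis using ij by simp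
  qed
  note 1 = this
  have "(D * M * D) $$ (i, j) = (\<Sum>l<N. (D * M) $$ (i, l) * D $$ (l, j))"
    by (rule index_mult_mat_sum[OF _ D]) (use ij D M in auto)
  also have "\<dots> = (\<Sum>l<N. if j = l then d i * M $$ (i, j) * d j else 0)"
    using ij by (intro sum.cong refl) (simp add: 1, auto simp: D_def)
  finally show ?thesis using ij by (simp add: mult_ac)
qed

lemma skew_EW_imp_tournament:
  assumes t: "t > 0" and EW: "EW_matrix (4 * t + 2) B" and sk: "skew_symmetric_pm1 (4 * t + 2) B"
  obtains A where "tournament_matrix (4 * t + 1) A" "char_poly A = tournament_poly t"
proof -
  define N where "N = 4 * t + 2"
  define n where "n = 4 * t + 1"
  have Nn: "N = Suc n" by (simp add: N_def n_def)
  define S where "S = B - 1\<^sub>m N"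
  define W where "W = S * S"
  have B: "B \<in> carrier_mat N N" and pm: "\<And>i j. i < N \<Longrightarrow> j < N \<Longrightarrow> B $$ (i, j) \<in> {1, -1}"
    and BB: "B + transpose_mat B = 2 \<cdot>\<^sub>m 1\<^sub>m N"
    using sk by (auto simp: skew_symmetric_pm1_def pm1_matrix_def N_def)
  have gram: "transpose_mat B * B = EW_gram t" using EW by (simp only: EW_matrix_iff_gram)
  have S: "S \<in> carrier_mat N N" and W: "W \<in> carrier_mat N N" using B by (auto simp: S_def W_def)
  have BBij: "B $$ (i, j) + B $$ (j, i) = (if i = j then 2 else 0)" if "i < N" "j < N" for i j
    using arg_cong[OF BB, of "\<lambda>M. M $$ (i, j)"] that B by auto
  have Sij: "S $$ (j, i) = - S $$ (i, j)" if "i < N" "j < N" for i j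
    using BBij[OF that] that B by (auto simp: S_def split: if_splits)
  have S0: "S $$ (i, i) = 0" if "i < N" for i using Sij[OF that that] by simp
  have S1: "S $$ (i, j) \<in> {1, -1}" if "i < N" "j < N" "i \<noteq> j" for i j
    using pm[of i j] that B by (auto simp: S_def)
  have skew: "transpose_mat S = - S"
    using S by (intro eq_matI) (auto intro: Sij)
  have tB: "transpose_mat B = 1\<^sub>m N - S"
  proof (rule eq_matI)
    fix i j assume "i < dim_row (1\<^sub>m N - S)" "j < dim_col (1\<^sub>m N - S)"
    hence "i < N" "j < N" using S by auto
    thus "transpose_mat B $$ (i, j) = (1\<^sub>m N - S) $$ (i, j)"
      using BBij[of i j] B by (auto simp: S_def split: if_splits)
  qed (use B S in auto)
  have "B = 1\<^sub>m N + S" using B by (intro eq_matI) (auto simp: S_def)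
  moreover have "(1::real) \<cdot>\<^sub>m 1\<^sub>m N = 1\<^sub>m N" by (rule eq_matI) auto
  ultimately have "EW_gram t = (1 \<cdot>\<^sub>m 1\<^sub>m N - S) * (1 \<cdot>\<^sub>m 1\<^sub>m N + S)" using gram tB by simp
  also have "\<dots> = 1\<^sup>2 \<cdot>\<^sub>m 1\<^sub>m N - W" unfolding W_def by (rule char_matrix_mult_conj[OF S])
  finally have W_gram: "EW_gram t = 1\<^sup>2 \<cdot>\<^sub>m 1\<^sub>m N - W" .
  have Wij: "W $$ (i, j) = - (4 * real t - 1) * of_bool (i = j)
      - 2 * of_bool (same_half (2 * t + 1) i j)" if "i < N" "j < N" for i j
    using arg_cong[OF W_gram, of "\<lambda>M. M $$ (i, j)"] that W
    by (auto simp: EW_gram_def N_def algebra_simps of_bool_def)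
  \<comment> \<open>Here W = -(cI + 2H) with c = 4t - 1 and H the block indicator. From H * H = (2t
    + 1) H, W is a root of the quadratic with zeros -(4t - 1) and -(8t + 1).\<close>
  have WWij: "(W * W) $$ (i, j) = - (12 * real t) * W $$ (i, j)
      - ((4 * real t - 1) * (8 * real t + 1)) * of_bool (i = j)" if ij: "i < N" "j < N" for i j
  proof -
    define h where "h k l = (of_bool (same_half (2 * t + 1) k l) :: real)" for k l
    have delta: "(\<Sum>k<N. of_bool (i = k) * f k) = f i" "(\<Sum>k<N. of_bool (k = j) * f k) = f j"
      for f :: "nat \<Rightarrow> real"
      using ij by (simp_all add: of_bool_def if_distrib[of "\<lambda>x. x * _"] cong: if_cong)
    define c where "c = 4 * real t - 1"
    have "(W * W) $$ (i, j) = (\<Sum>k<N. W $$ (i, k) * W $$ (k, j))"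
      by (rule index_mult_mat_sum[OF W W ij])
    also have "\<dots> = (\<Sum>k<N. (c * of_bool (i = k) + 2 * h i k) * (c * of_bool (k = j) + 2 * h k j))"
      using ij by (intro sum.cong) (auto simp: Wij h_def c_def algebra_simps)
    also have "\<dots> = (\<Sum>k<N. of_bool (i = k) * (c\<^sup>2 * of_bool (k = j) + 2 * c * h k j)
        + of_bool (k = j) * (2 * c * h i k) + 4 * (h i k * h k j))"
      by (intro sum.cong) (simp_all add: algebra_simps power2_eq_square)
    also have "\<dots> = c\<^sup>2 * of_bool (i = j) + 2 * c * h i j + 2 * c * h i j + 4 * (\<Sum>k<N. h i k * h k j)"
      by (simp add: sum.distrib delta sum_distrib_left)
    also have "(\<Sum>k<N. h i k * h k j) = real (2 * t + 1) * h i j"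
      using sum_same_half[of i "2 * t + 1" j] ij by (simp add: h_def N_def)
    finally show ?thesis using ij
      by (simp add: Wij c_def h_def algebra_simps power2_eq_square)
  qed
  \<comment> \<open>The Gram matrix determines only the square of the characteristic polynomial;
    being monic then settles the sign.\<close>
  have cpS: "char_poly S = seidel_poly t"
  proof -
    have "(poly (char_poly S) x)\<^sup>2 = (poly (seidel_poly t) x)\<^sup>2" for x
    proof -
      define q where "q = x\<^sup>2 + (4 * real t - 1)"
      have "real t \<ge> 1" using t by simp
      hence q: "q \<noteq> 0" unfolding q_def by (smt (verit) zero_le_power2)
      define m where "m = 2 * t + 1"
      let ?J = "q \<cdot>\<^sub>m 1\<^sub>m m + 2 \<cdot>\<^sub>m all_ones_mat m"
      have "(poly (char_poly S) x)\<^sup>2 = det (x\<^sup>2 \<cdot>\<^sub>m 1\<^sub>m N - W)"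
        by (simp add: poly_char_poly[OF S] det_skew_sq[OF S skew] W_def)
      also have "x\<^sup>2 \<cdot>\<^sub>m 1\<^sub>m N - W = four_block_mat ?J (0\<^sub>m m m) (0\<^sub>m m m) ?J"
        using W by (intro eq_matI)
          (auto simp: Wij all_ones_mat_def q_def m_def N_def same_half_def simp del: of_nat_add of_nat_mult)
      also have "det \<dots> = (det ?J)\<^sup>2"
        by (subst det_four_block_mat_upper_right_zero[of _ m _ m])
          (auto simp: all_ones_mat_def power2_eq_square)
      also have "det ?J = q ^ (2 * t) * (x\<^sup>2 + (8 * real t + 1))"
        by (subst det_scalar_plus_all_ones[OF q]) (auto simp: m_def q_def)
      finally show ?thesis by (simp add: poly_seidel_poly q_def)
    qed
    hence "char_poly S ^ 2 = seidel_poly t ^ 2"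
      by (simp add: poly_eq_poly_eq_iff[symmetric] fun_eq_iff)
    hence "char_poly S = seidel_poly t \<or> char_poly S = - seidel_poly t"
      by (simp add: power2_eq_iff)
    moreover have "lead_coeff (char_poly S) = 1" using degree_monic_char_poly[OF S] by auto
    moreover have "lead_coeff (seidel_poly t) = 1"
      unfolding seidel_poly_def lead_coeff_mult lead_coeff_power by simp
    ultimately show ?thesis by auto
  qed
  \<comment> \<open>Switching by row 0 of S turns that row into ones off the diagonal. The entry at
    (0, 0) is zero, not a sign, so \<open>d 0\<close> is set to 1.\<close>
  define d where "d i = (if i = 0 then 1 else S $$ (0, i))" for i
  have dd: "d i * d i = 1" if "i < N" for i
    using S1[of 0 i] that by (auto simp: d_def N_def)
  have d: "d i \<in> {1, -1}" if "i < N" for i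
    using S1[of 0 i] that by (auto simp: d_def N_def)
  define D where "D = mat N N (\<lambda>(i, j). if i = j then d i else 0)"
  have D: "D \<in> carrier_mat N N" by (simp add: D_def)
  have DD: "D * D = 1\<^sub>m N"
    using diag_conj_mat[of "1\<^sub>m N" N _ _ d] D
    by (intro eq_matI) (auto simp: D_def[symmetric] dd simp del: index_mult_mat(1))
  define S' where "S' = D * S * D"
  have S': "S' \<in> carrier_mat N N" using D S by (simp add: S'_def)
  have S'ij: "S' $$ (i, j) = d i * d j * S $$ (i, j)" if "i < N" "j < N" for i j
    using diag_conj_mat[OF S that, of d] by (simp add: S'_def D_def)
  have conj_mult: "D * X * D * (D * Y * D) = D * (X * Y) * D"
    if "X \<in> carrier_mat N N" "Y \<in> carrier_mat N N" for X Y
  proof -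
    have "D * X * D * (D * Y * D) = D * X * (D * D) * Y * D"
      using that D by (simp add: assoc_mult_mat[of _ N N _ N _ N])
    also have "\<dots> = D * (X * Y) * D"
      using that D by (simp add: DD assoc_mult_mat[of _ N N _ N _ N])
    finally show ?thesis .
  qed
  have W': "S' * S' = D * W * D" unfolding S'_def W_def using conj_mult[OF S S] .
  have W'ij: "(S' * S') $$ (i, j) = d i * d j * W $$ (i, j)" if "i < N" "j < N" for i j
    unfolding W' D_def by (rule diag_conj_mat[OF W that])
  have skew': "transpose_mat S' = - S'"
  proof (rule eq_matI)
    fix i j assume "i < dim_row (- S')" "j < dim_col (- S')"
    hence "i < N" "j < N" using S' by auto
    thus "transpose_mat S' $$ (i, j) = (- S') $$ (i, j)"
      using S' Sij[of i j] by (simp add: S'ij)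
  qed (use S' in auto)
  \<comment> \<open>Inverts K = 2A - J + I off the diagonal; the diagonal is set separately, since
    the formula would give 1/2 there.\<close>
  define A where "A = mat n n (\<lambda>(i, j). if i = j then 0 else (1 + S' $$ (Suc i, Suc j)) / 2)"
  have S'1: "S' $$ (i, j) \<in> {1, -1}" if "i < N" "j < N" "i \<noteq> j" for i j
    using S1[OF that] d[of i] d[of j] that by (auto simp: S'ij)
  have T: "tournament_matrix n A"
    unfolding tournament_matrix_def
  proof (intro conjI allI impI)
    show "A \<in> carrier_mat n n" by (simp add: A_def)
    show "A $$ (i, j) \<in> {0, 1}" if "i < n" "j < n" for i j
      using that S'1[of "Suc i" "Suc j"] by (auto simp: A_def Nn)
    show "A + transpose_mat A = all_ones_mat n - 1\<^sub>m n"
    proof (rule eq_matI)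
      fix i j assume "i < dim_row (all_ones_mat n - 1\<^sub>m n)" "j < dim_col (all_ones_mat n - 1\<^sub>m n)"
      hence ij: "i < n" "j < n" by auto
      have "S' $$ (Suc j, Suc i) = - S' $$ (Suc i, Suc j)"
        using ij Sij[of "Suc i" "Suc j"] by (simp add: S'ij Nn)
      thus "(A + transpose_mat A) $$ (i, j) = (all_ones_mat n - 1\<^sub>m n) $$ (i, j)"
        using ij by (auto simp: A_def all_ones_mat_def field_simps)
    qed (auto simp: A_def all_ones_mat_def)
  qed
  have seid: "seidel_mat n A = S'"
  proof (rule eq_matI)
    fix i j assume "i < dim_row S'" "j < dim_col S'"
    hence ij: "i < N" "j < N" using S' by auto
    have "S' $$ (0, j) = 1" if "j > 0"
      using that ij dd[of j] by (auto simp: S'ij d_def)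
    moreover have "S' $$ (i, 0) = -1" if "i > 0"
      using that ij dd[of i] Sij[of 0 i] by (auto simp: S'ij d_def)
    moreover have "S' $$ (j, i) = - S' $$ (i, j)" "S' $$ (i, i) = 0" "S' $$ (0, 0) = 0"
      using ij Sij[of i j] S0[of i] S0[of 0] by (auto simp: S'ij)
    ultimately show "seidel_mat n A $$ (i, j) = S' $$ (i, j)"
      using ij by (cases i; cases j) (auto simp: seidel_mat_def Nn A_def field_simps)
  qed (use S' in \<open>auto simp: seidel_mat_def Nn\<close>)
  have "similar_mat S' S"
    by (rule similar_matI[of _ _ D D N]) (use S S' D DD in \<open>auto simp: S'_def\<close>)
  hence cpS': "char_poly S' = seidel_poly t" using char_poly_similar cpS by metis
  \<comment> \<open>Switching may change signs in W off the diagonal, but it preserves the quadratic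
    relation and the diagonal, which is what the cofactor formula needs.\<close>
  have WW': "S' * S' * (S' * S') = - (12 * real t) \<cdot>\<^sub>m (S' * S')
      - ((4 * real t - 1) * (8 * real t + 1)) \<cdot>\<^sub>m 1\<^sub>m N"
  proof (rule eq_matI)
    fix i j assume "i < dim_row (- (12 * real t) \<cdot>\<^sub>m (S' * S')
      - ((4 * real t - 1) * (8 * real t + 1)) \<cdot>\<^sub>m 1\<^sub>m N)" "j < dim_col (- (12 * real t) \<cdot>\<^sub>m (S' * S')
      - ((4 * real t - 1) * (8 * real t + 1)) \<cdot>\<^sub>m 1\<^sub>m N)"
    hence ij: "i < N" "j < N" by auto
    have "(S' * S' * (S' * S')) $$ (i, j) = d i * d j * (W * W) $$ (i, j)"
      using diag_conj_mat[of "W * W" N i j d] conj_mult[OF W W] W ij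
      by (simp add: W' D_def del: index_mult_mat(1))
    also have "\<dots> = - (12 * real t) * (S' * S') $$ (i, j)
        - ((4 * real t - 1) * (8 * real t + 1)) * of_bool (i = j)"
      using ij dd[of i] by (cases "i = j") (simp_all add: WWij W'ij del: mult_minus_left)
    finally show "(S' * S' * (S' * S')) $$ (i, j) = (- (12 * real t) \<cdot>\<^sub>m (S' * S')
      - ((4 * real t - 1) * (8 * real t + 1)) \<cdot>\<^sub>m 1\<^sub>m N) $$ (i, j)"
      using ij S' by (simp del: index_mult_mat(1))
  qed (use S' in auto)
  have "(S' * S') $$ (0, 0) = - (4 * real t + 1)"
    using W'ij[of 0 0] Wij[of 0 0] dd[of 0] by (simp add: N_def same_half_def)
  moreover have "det (x \<cdot>\<^sub>m 1\<^sub>m N - S') = (x\<^sup>2 + (4 * real t - 1)) ^ (2 * t) * (x\<^sup>2 + (8 * real t + 1))" for x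
    by (simp only: poly_char_poly[OF S', symmetric] cpS' poly_seidel_poly)
  moreover have "N > 0" by (simp add: N_def)
  ultimately have "cofactor (x \<cdot>\<^sub>m 1\<^sub>m N - S') 0 0
    = (x\<^sup>2 + (4 * real t - 1)) ^ (2 * t - 1) * (x * (x\<^sup>2 + (8 * real t - 1)))" for x
    using cofactor_resolvent_skew[OF S' _ skew' t WW'] by blast
  hence "char_poly A = tournament_poly t"
    using char_poly_tournament[OF T[unfolded n_def] t] seid cpS' by (simp add: Nn n_def)
  thus ?thesis using that T by (simp add: n_def)
qed

section \<open>From tournaments to skew EW matrices\<close>

lemma gram_eq_0_imp_eq_0:
  fixes M :: "real mat"
  assumes M: "M \<in> carrier_mat n k" and 0: "transpose_mat M * M = 0\<^sub>m k k"
  shows "M = 0\<^sub>m n k"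
proof (rule eq_matI)
  fix i j assume "i < dim_row (0\<^sub>m n k :: real mat)" "j < dim_col (0\<^sub>m n k :: real mat)"
  hence ij: "i < n" "j < k" by auto
  have "transpose_mat M \<in> carrier_mat k n" using M by auto
  from index_mult_mat_sum[OF this M ij(2) ij(2)]
  have "(\<Sum>l<n. M $$ (l, j) * M $$ (l, j)) = 0" using 0 M ij by simp
  hence "\<forall>l\<in>{..<n}. M $$ (l, j) * M $$ (l, j) = 0"
    by (subst (asm) sum_nonneg_eq_0_iff) auto
  thus "M $$ (i, j) = 0\<^sub>m n k $$ (i, j)" using ij by simp
qed (use M in auto)

text \<open>For symmetric real G, the Gram matrix of GZ is Z^T G G Z, so G G Z = 0 forces G Z = 0.
  Stripping one power at a time takes the place of diagonalising G.\<close>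

lemma symmetric_pow_mult_eq_0:
  fixes G Z :: "real mat"
  assumes G: "G \<in> carrier_mat n n" and sym: "transpose_mat G = G" and k: "k > 0"
    and Z: "Z \<in> carrier_mat n n" and 0: "G ^\<^sub>m k * Z = 0\<^sub>m n n"
  shows "G * Z = 0\<^sub>m n n"
  using k Z 0
proof (induct k arbitrary: Z rule: nat_induct_non_zero)
  case 1
  then show ?case using G by simp
next
  case (Suc k)
  have "G ^\<^sub>m k * (G * Z) = 0\<^sub>m n n"
    using Suc.prems G by (simp add: assoc_mult_mat[of _ n n _ n _ n] pow_carrier_mat)
  hence GGZ: "G * (G * Z) = 0\<^sub>m n n" using Suc.hyps Suc.prems G by auto
  have "transpose_mat (G * Z) * (G * Z) = transpose_mat Z * (G * (G * Z))"
    using Suc.prems G sym by (simp add: transpose_mult[of _ n n _ n] assoc_mult_mat[of _ n n _ n _ n])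
  also have "\<dots> = 0\<^sub>m n n" using Suc.prems by (simp add: GGZ)
  finally show ?case using gram_eq_0_imp_eq_0[of "G * Z" n n] Suc.prems G by auto
qed

text \<open>Two rows of a correlation matrix satisfying p^2 = m p are equal up to sign as soon as their
  common entry is nonzero, since the squared distance of rows i and s j is 2 m (1 - s p i j).\<close>

lemma two_class_decomposition:
  fixes p :: "nat \<Rightarrow> nat \<Rightarrow> real"
  assumes m: "m > 0"
    and sym: "\<And>i j. i < 2 * m \<Longrightarrow> j < 2 * m \<Longrightarrow> p i j = p j i"
    and diag: "\<And>i. i < 2 * m \<Longrightarrow> p i i = 1"
    and int: "\<And>i j. i < 2 * m \<Longrightarrow> j < 2 * m \<Longrightarrow> p i j \<in> \<int>"
    and idem: "\<And>i j. i < 2 * m \<Longrightarrow> j < 2 * m \<Longrightarrow> (\<Sum>k<2 * m. p i k * p k j) = real m * p i j"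
  obtains d U where "U \<subseteq> {..<2 * m}" "card U = m" "\<And>i. i < 2 * m \<Longrightarrow> d i \<in> {1, -1 :: real}"
    "\<And>i j. i < 2 * m \<Longrightarrow> j < 2 * m \<Longrightarrow> p i j = d i * d j * of_bool (i \<in> U \<longleftrightarrow> j \<in> U)"
proof -
  define N where "N = 2 * m"
  have dist: "(\<Sum>k<N. (p i k - s * p j k)\<^sup>2) = 2 * real m * (1 - s * p i j)"
    if ij: "i < N" "j < N" and s: "s * s = 1" for i j s
  proof -
    have "(\<Sum>k<N. (p i k - s * p j k)\<^sup>2)
        = (\<Sum>k<N. p i k * p k i + (s * s) * (p j k * p k j) - 2 * s * (p i k * p k j))"
      using ij sym by (intro sum.cong) (auto simp: N_def power2_eq_square algebra_simps)
    also have "\<dots> = (\<Sum>k<N. p i k * p k i) + (\<Sum>k<N. p j k * p k j) - 2 * s * (\<Sum>k<N. p i k * p k j)"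
      by (simp add: s sum.distrib sum_subtractf sum_distrib_left)
    also have "\<dots> = 2 * real m * (1 - s * p i j)"
      using ij idem[of i i] idem[of j j] idem[of i j] diag by (simp add: N_def right_diff_distrib)
    finally show ?thesis .
  qed
  \<comment> \<open>Nonnegative distances for s = 1 and s = -1 bound the entry by 1 in absolute
    value; integrality leaves three values.\<close>
  have val: "p i j \<in> {0, 1, -1}" if ij: "i < N" "j < N" for i j
  proof -
    have "0 \<le> 2 * real m * (1 - s * p i j)" if "s * s = 1" for s
      unfolding dist[OF ij that, symmetric] by (rule sum_nonneg) simp
    from this[of 1] this[of "-1"] have "\<bar>p i j\<bar> \<le> 1" using m by (simp add: zero_le_mult_iff)
    moreover obtain z where "p i j = of_int z" using int[of i j] ij unfolding N_def by (metis Ints_cases)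
    ultimately have "\<bar>z\<bar> \<le> 1" by linarith
    hence "z = 0 \<or> z = 1 \<or> z = -1" by auto
    thus ?thesis using \<open>p i j = of_int z\<close> by auto
  qed
  \<comment> \<open>A nonzero entry is a sign, and taking it as s makes the distance vanish.\<close>
  have rows: "p i k = p i j * p j k" if ij: "i < N" "j < N" "p i j \<noteq> 0" and k: "k < N" for i j k
  proof -
    have s: "p i j * p i j = 1" using val[of i j] ij by auto
    have "(\<Sum>k<N. (p i k - p i j * p j k)\<^sup>2) = 0" using dist[OF ij(1,2) s] s by simp
    thus ?thesis using k by (simp add: sum_nonneg_eq_0_iff)
  qed
  define R where "R i = {k. k < N \<and> p i k \<noteq> 0}" for i
  \<comment> \<open>The squared norm of row i is m, and each nonzero entry contributes exactly
    1.\<close>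
  have R: "card (R i) = m" if i: "i < N" for i
  proof -
    have "real m = (\<Sum>k<N. p i k * p k i)" using idem[of i i] diag[of i] i by (simp add: N_def)
    also have "\<dots> = (\<Sum>k<N. if p i k \<noteq> 0 then 1 else 0)"
    proof (intro sum.cong refl)
      fix k assume "k \<in> {..<N}"
      thus "p i k * p k i = (if p i k \<noteq> 0 then 1 else 0)"
        using val[of i k] sym[of k i] i by (auto simp: N_def)
    qed
    also have "\<dots> = real (card (R i))"
      by (subst sum.inter_filter[symmetric]) (auto simp: R_def)
    finally show ?thesis by simp
  qed
  define U where "U = R 0"
  have N0: "0 < N" using m by (simp add: N_def)
  have UN: "U \<subseteq> {..<N}" by (auto simp: U_def R_def)
  have cU: "card U = m" using R[OF N0] by (simp add: U_def)
  have cV: "card ({..<N} - U) = m" using UN cU by (simp add: card_Diff_subset finite_subset N_def)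
  hence "{..<N} - U \<noteq> {}" using m by (metis card.empty less_numeral_extra(3))
  then obtain v where "v \<in> {..<N} - U" by blast
  hence v: "v < N" "p 0 v = 0" by (auto simp: U_def R_def)
  \<comment> \<open>A common support point k of rows 0 and v would make \<open>p 0 v\<close> a
    product of nonzero entries. By cardinality, the support of row v is then the whole complement of
    U.\<close>
  have "R v \<subseteq> {..<N} - U"
  proof
    fix k assume "k \<in> R v"
    hence k: "k < N" "p v k \<noteq> 0" by (auto simp: R_def)
    have "p 0 k = 0"
    proof (rule ccontr)
      assume "p 0 k \<noteq> 0"
      from rows[OF N0 k(1) this v(1)] v k sym[of v k] \<open>p 0 k \<noteq> 0\<close> show False by (auto simp: N_def)
    qed
    thus "k \<in> {..<N} - U" using k by (auto simp: U_def R_def)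
  qed
  hence Rv: "R v = {..<N} - U" using R[OF v(1)] cV by (intro card_subset_eq) auto
  \<comment> \<open>0 and v represent the two classes; the sign of i is its entry in the row of its
    representative.\<close>
  define w where "w i = (if i \<in> U then 0 else v)" for i
  define d where "d i = p (w i) i" for i
  have w: "w i < N" "d i \<noteq> 0" "(p (w i) j \<noteq> 0) = (i \<in> U \<longleftrightarrow> j \<in> U)" if "i < N" "j < N" for i j
  proof -
    show "w i < N" using N0 v by (auto simp: w_def)
    have *: "(p (w i) j \<noteq> 0) = (i \<in> U \<longleftrightarrow> j \<in> U)" if "i < N" "j < N" for i j
      using that Rv by (auto simp: w_def U_def R_def)
    show "(p (w i) j \<noteq> 0) = (i \<in> U \<longleftrightarrow> j \<in> U)" using * that by blast
    show "d i \<noteq> 0" using *[of i i] that by (simp add: d_def)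
  qed
  have dv: "d i \<in> {1, -1}" if "i < N" for i
    using val[of "w i" i] w(1,2)[OF that that] that by (auto simp: d_def)
  show ?thesis
  proof (rule that[of U d])
    show "U \<subseteq> {..<2 * m}" "card U = m" using UN cU by (auto simp: N_def)
    show "d i \<in> {1, -1}" if "i < 2 * m" for i using dv that by (simp add: N_def)
    fix i j assume "i < 2 * m" "j < 2 * m"
    hence ij: "i < N" "j < N" by (auto simp: N_def)
    have "p (w i) j = d i * p i j"
      using rows[of "w i" i j] w[OF ij(1) ij(1)] ij by (simp add: d_def)
    hence 1: "p i j = d i * p (w i) j" using dv[OF ij(1)] by auto
    show "p i j = d i * d j * of_bool (i \<in> U \<longleftrightarrow> j \<in> U)"
    proof (cases "i \<in> U \<longleftrightarrow> j \<in> U")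
      case True
      hence "w i = w j" by (simp add: w_def)
      thus ?thesis using 1 True by (simp add: d_def)
    next
      case False
      thus ?thesis using 1 w(3)[OF ij] by simp
    qed
  qed
qed

section \<open>Sorting the classes into blocks and building the EW matrix\<close>

lemma bij_betw_half:
  assumes "U \<subseteq> {..<2 * m}" "card U = m"
  obtains \<pi> where "bij_betw \<pi> {..<2 * m} {..<2 * m}" "\<And>i. i < 2 * m \<Longrightarrow> \<pi> i \<in> U \<longleftrightarrow> i < m"
proof -
  have fU: "finite U" using assms(1) finite_subset by blast
  obtain f where f: "bij_betw f {..<m} U"
    using finite_same_card_bij[of "{..<m}" U] assms fU by auto
  have "card ({..<2 * m} - U) = m" using assms fU by (simp add: card_Diff_subset)
  then obtain g where g: "bij_betw g {m..<2 * m} ({..<2 * m} - U)"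
    using finite_same_card_bij[of "{m..<2 * m}" "{..<2 * m} - U"] by auto
  define \<pi> where "\<pi> i = (if i < m then f i else g i)" for i
  have "bij_betw \<pi> {..<m} U \<longleftrightarrow> bij_betw f {..<m} U"
    "bij_betw \<pi> {m..<2 * m} ({..<2 * m} - U) \<longleftrightarrow> bij_betw g {m..<2 * m} ({..<2 * m} - U)"
    by (rule bij_betw_cong, simp add: \<pi>_def)+
  hence 1: "bij_betw \<pi> {..<m} U" "bij_betw \<pi> {m..<2 * m} ({..<2 * m} - U)"
    using f g by simp_all
  from bij_betw_combine[OF 1] have "bij_betw \<pi> ({..<m} \<union> {m..<2 * m}) (U \<union> ({..<2 * m} - U))"
    by auto
  moreover have "{..<m} \<union> {m..<2 * m} = {..<2 * m}" "U \<union> ({..<2 * m} - U) = {..<2 * m}"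
    using assms by auto
  ultimately have "bij_betw \<pi> {..<2 * m} {..<2 * m}" by simp
  moreover have "\<pi> i \<in> U \<longleftrightarrow> i < m" if "i < 2 * m" for i
  proof (cases "i < m")
    case True
    then show ?thesis using bij_betwE[OF 1(1)] by auto
  next
    case False
    then show ?thesis using bij_betwE[OF 1(2)] that by auto
  qed
  ultimately show ?thesis using that by blast
qed

lemma seidel_mat_sign:
  assumes T: "tournament_matrix n A" and ij: "i < Suc n" "j < Suc n"
  shows "seidel_mat n A $$ (j, i) = - seidel_mat n A $$ (i, j)"
    "i \<noteq> j \<Longrightarrow> seidel_mat n A $$ (i, j) \<in> {1, -1}"
proof -
  show "seidel_mat n A $$ (j, i) = - seidel_mat n A $$ (i, j)"
    using ij by (simp add: seidel_mat_def)
  assume "i \<noteq> j"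
  show "seidel_mat n A $$ (i, j) \<in> {1, -1}"
  proof (cases "i = 0 \<or> j = 0")
    case True
    thus ?thesis using ij \<open>i \<noteq> j\<close> by (auto simp: seidel_mat_def)
  next
    case False
    hence "i - 1 < n" "j - 1 < n" "i - 1 \<noteq> j - 1" using ij \<open>i \<noteq> j\<close> by auto
    with tournament_matrix_entries[OF T, of "i - 1" "j - 1"] False ij
    show ?thesis by (auto simp: seidel_mat_def)
  qed
qed

text \<open>Each sign is 1 + 2z with z in {0, -1}, so the sum has the parity of the number of
  terms.\<close>

lemma half_sum_signs_Ints:
  fixes x :: "nat \<Rightarrow> real"
  assumes "\<And>k. k \<in> K \<Longrightarrow> x k \<in> {1, -1}" "even (card K)"
  shows "sum x K / 2 \<in> \<int>"
proof -
  have "sum x K = (\<Sum>k\<in>K. 1 + 2 * ((x k - 1) / 2))" by (simp add: field_simps)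
  also have "\<dots> = real (card K) + 2 * (\<Sum>k\<in>K. (x k - 1) / 2)"
    by (simp only: sum.distrib sum_distrib_left) simp
  finally have "sum x K / 2 = real (card K div 2) + (\<Sum>k\<in>K. (x k - 1) / 2)"
    using assms(2) by (auto simp: real_of_nat_div)
  moreover have "(\<Sum>k\<in>K. (x k - 1) / 2) \<in> \<int>"
    using assms(1) by (intro Ints_sum) fastforce
  ultimately show ?thesis by (metis Ints_add Ints_of_nat)
qed

text \<open>A permutation moves U to the first half, and switching by d cancels the signs
  \<open>d i * d j\<close> in the Gram matrix. Adding the identity then gives B.\<close>

lemma skew_EW_of_two_classes:
  fixes S :: "nat \<Rightarrow> nat \<Rightarrow> real" and t :: nat
  defines "m \<equiv> 2 * t + 1"
  assumes skew: "\<And>i j. i < 2 * m \<Longrightarrow> j < 2 * m \<Longrightarrow> S j i = - S i j"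
    and sign: "\<And>i j. i < 2 * m \<Longrightarrow> j < 2 * m \<Longrightarrow> i \<noteq> j \<Longrightarrow> S i j \<in> {1, -1}"
    and U: "U \<subseteq> {..<2 * m}" "card U = m" and d: "\<And>i. i < 2 * m \<Longrightarrow> d i \<in> {1, -1}"
    and gram: "\<And>i j. i < 2 * m \<Longrightarrow> j < 2 * m \<Longrightarrow> (\<Sum>k<2 * m. S i k * S j k)
      = (4 * real t - 1) * of_bool (i = j) + 2 * (d i * d j * of_bool (i \<in> U \<longleftrightarrow> j \<in> U))"
  obtains B where "EW_matrix (4 * t + 2) B" "skew_symmetric_pm1 (4 * t + 2) B"
proof -
  define N where "N = 4 * t + 2"
  have Nm: "2 * m = N" by (simp add: m_def N_def)
  obtain \<pi> where \<pi>: "bij_betw \<pi> {..<N} {..<N}" and \<pi>U: "\<And>i. i < N \<Longrightarrow> \<pi> i \<in> U \<longleftrightarrow> i < m"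
    using bij_betw_half[OF U] unfolding Nm by metis
  have \<pi>N: "\<pi> i < N" if "i < N" for i using bij_betwE[OF \<pi>] that by auto
  have \<pi>_inj: "\<pi> i = \<pi> j \<longleftrightarrow> i = j" if "i < N" "j < N" for i j
    using \<pi> that by (auto simp: bij_betw_def inj_on_def)
  define a where "a i j = d (\<pi> i) * d (\<pi> j) * S (\<pi> i) (\<pi> j)" for i j
  have a_skew: "a j i = - a i j" if "i < N" "j < N" for i j
    using skew[of "\<pi> i" "\<pi> j"] \<pi>N that by (simp add: a_def Nm)
  have a_sign: "a i j \<in> {1, -1}" if "i < N" "j < N" "i \<noteq> j" for i j
    using sign[of "\<pi> i" "\<pi> j"] d[of "\<pi> i"] d[of "\<pi> j"] \<pi>N \<pi>_inj that by (auto simp: a_def Nm)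
  have a_diag: "a i i = 0" if "i < N" for i using a_skew[OF that that] by simp
  have a_gram: "(\<Sum>k<N. a i k * a j k)
      = (4 * real t - 1) * of_bool (i = j) + 2 * of_bool (same_half m i j)" if ij: "i < N" "j < N" for i j
  proof -
    have dd: "d (\<pi> k) * d (\<pi> k) = 1" if "k < N" for k using d[of "\<pi> k"] \<pi>N that by (auto simp: Nm)
    have "(\<Sum>k<N. a i k * a j k)
        = (\<Sum>k<N. d (\<pi> i) * d (\<pi> j) * (S (\<pi> i) (\<pi> k) * S (\<pi> j) (\<pi> k)) * (d (\<pi> k) * d (\<pi> k)))"
      by (intro sum.cong) (simp_all add: a_def)
    also have "\<dots> = (\<Sum>k<N. d (\<pi> i) * d (\<pi> j) * (S (\<pi> i) (\<pi> k) * S (\<pi> j) (\<pi> k)))"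
      by (intro sum.cong) (simp_all add: dd)
    also have "\<dots> = d (\<pi> i) * d (\<pi> j) * (\<Sum>k<N. S (\<pi> i) (\<pi> k) * S (\<pi> j) (\<pi> k))"
      by (simp add: sum_distrib_left)
    also have "(\<Sum>k<N. S (\<pi> i) (\<pi> k) * S (\<pi> j) (\<pi> k)) = (\<Sum>k<N. S (\<pi> i) k * S (\<pi> j) k)"
      by (rule sum.reindex_bij_betw[OF \<pi>])
    also have "\<dots> = (4 * real t - 1) * of_bool (i = j)
        + 2 * (d (\<pi> i) * d (\<pi> j) * of_bool (same_half m i j))"
      using gram[of "\<pi> i" "\<pi> j"] \<pi>N \<pi>U \<pi>_inj ij by (simp add: Nm same_half_def)
    finally show ?thesis using dd[OF ij(1)] dd[OF ij(2)] by (auto simp: algebra_simps)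
  qed
  define B where "B = mat N N (\<lambda>(i, j). of_bool (i = j) + a i j)"
  have B: "B \<in> carrier_mat N N" by (simp add: B_def)
  have tB: "transpose_mat B \<in> carrier_mat N N" using B by simp
  have delta: "(\<Sum>k<N. of_bool (i = k) * f k) = f i" if "i < N" for f :: "nat \<Rightarrow> real" and i
    using that by (simp add: of_bool_def if_distrib[of "\<lambda>x. x * _"] cong: if_cong)
  \<comment> \<open>The case s = 1 is B B^T and s = -1 is B^T B, since B^T = I - a. In both, the
    cross terms cancel by skewness.\<close>
  have gram_sum: "(\<Sum>k<N. (of_bool (i = k) + s * a i k) * (of_bool (j = k) + s * a j k))
      = EW_gram t $$ (i, j)" if ij: "i < N" "j < N" and s: "s * s = 1" for i j s
  proof -
    have "(\<Sum>k<N. (of_bool (i = k) + s * a i k) * (of_bool (j = k) + s * a j k))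
        = (\<Sum>k<N. of_bool (i = k) * (of_bool (j = k) + s * a j k) + of_bool (j = k) * (s * a i k)
            + (s * s) * (a i k * a j k))"
      by (intro sum.cong) (simp_all add: algebra_simps)
    also have "\<dots> = of_bool (j = i) + s * a j i + s * a i j + (\<Sum>k<N. a i k * a j k)"
      using ij by (simp add: sum.distrib delta s)
    also have "\<dots> = EW_gram t $$ (i, j)"
      unfolding a_gram[OF ij] using ij a_skew[OF ij] by (simp add: EW_gram_def N_def m_def)
    finally show ?thesis .
  qed
  have "B * transpose_mat B = EW_gram t"
  proof (rule eq_matI)
    fix i j assume "i < dim_row (EW_gram t)" "j < dim_col (EW_gram t)"
    hence ij: "i < N" "j < N" by (auto simp: EW_gram_def N_def)
    have "(B * transpose_mat B) $$ (i, j)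
        = (\<Sum>k<N. (of_bool (i = k) + 1 * a i k) * (of_bool (j = k) + 1 * a j k))"
      unfolding index_mult_mat_sum[OF B tB ij] using ij by (intro sum.cong) (auto simp: B_def)
    thus "(B * transpose_mat B) $$ (i, j) = EW_gram t $$ (i, j)"
      using gram_sum[OF ij, of 1] by simp
  qed (auto simp: EW_gram_def B_def N_def)
  moreover have "transpose_mat B * B = EW_gram t"
  proof (rule eq_matI)
    fix i j assume "i < dim_row (EW_gram t)" "j < dim_col (EW_gram t)"
    hence ij: "i < N" "j < N" by (auto simp: EW_gram_def N_def)
    have "(transpose_mat B * B) $$ (i, j)
        = (\<Sum>k<N. (of_bool (i = k) + (-1) * a i k) * (of_bool (j = k) + (-1) * a j k))"
      unfolding index_mult_mat_sum[OF tB B ij]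
    proof (intro sum.cong refl)
      fix k assume "k \<in> {..<N}"
      thus "transpose_mat B $$ (i, k) * B $$ (k, j)
          = (of_bool (i = k) + (-1) * a i k) * (of_bool (j = k) + (-1) * a j k)"
        using ij a_skew[of i k] a_skew[of j k] by (auto simp: B_def)
    qed
    thus "(transpose_mat B * B) $$ (i, j) = EW_gram t $$ (i, j)"
      using gram_sum[OF ij, of "-1"] by simp
  qed (auto simp: EW_gram_def B_def N_def)
  moreover have pm: "pm1_matrix N B"
    unfolding pm1_matrix_def
  proof (intro conjI allI impI)
    fix i j assume "i < N" "j < N"
    thus "B $$ (i, j) \<in> {1, -1}"
      using a_sign[of i j] a_diag[of i] by (cases "i = j") (auto simp: B_def)
  qed (rule B)
  moreover have "B + transpose_mat B = 2 \<cdot>\<^sub>m 1\<^sub>m N"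
  proof (rule eq_matI)
    fix i j assume "i < dim_row (2 \<cdot>\<^sub>m 1\<^sub>m N :: real mat)" "j < dim_col (2 \<cdot>\<^sub>m 1\<^sub>m N :: real mat)"
    hence "i < N" "j < N" by auto
    thus "(B + transpose_mat B) $$ (i, j) = (2 \<cdot>\<^sub>m 1\<^sub>m N) $$ (i, j)"
      using a_skew[of i j] a_diag[of i] by (auto simp: B_def)
  qed (auto simp: B_def)
  ultimately have "EW_matrix N B" "skew_symmetric_pm1 N B"
    unfolding N_def EW_matrix_iff_gram skew_symmetric_pm1_def by auto
  thus ?thesis using that by (simp add: N_def)
qed

lemma tournament_imp_skew_EW:
  assumes t: "t > 0" and T: "tournament_matrix (4 * t + 1) A"
    and f: "char_poly A = tournament_poly t"
  obtains B where "EW_matrix (4 * t + 2) B" "skew_symmetric_pm1 (4 * t + 2) B"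
proof -
  define m where "m = 2 * t + 1"
  define N where "N = 2 * m"
  have N: "Suc (4 * t + 1) = N" "N = 4 * t + 2" by (auto simp: N_def m_def)
  define S where "S = seidel_mat (4 * t + 1) A"
  have S: "S \<in> carrier_mat N N" using seidel_mat_carrier[of "4 * t + 1" A] unfolding N(1) S_def .
  have skew: "S $$ (j, i) = - S $$ (i, j)" if "i < N" "j < N" for i j
    using seidel_mat_sign(1)[OF T, unfolded N(1), OF that] by (simp add: S_def)
  have sign: "S $$ (i, j) \<in> {1, -1}" if "i < N" "j < N" "i \<noteq> j" for i j
    using seidel_mat_sign(2)[OF T, unfolded N(1), OF that] by (simp add: S_def)
  have S0: "S $$ (i, i) = 0" if "i < N" for i using skew[OF that that] by simp
  define g where "g i j = (\<Sum>k<N. S $$ (i, k) * S $$ (j, k))" for i j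
  define p where "p i j = (g i j - (4 * real t - 1) * of_bool (i = j)) / 2" for i j
  \<comment> \<open>G and Z are the two factors of \<open>seidel_poly t\<close> evaluated at S. In
    terms of P they are -2P and 2mI - 2P, so G Z = 0 amounts to P * P = m P.\<close>
  define G where "G = (4 * real t - 1) \<cdot>\<^sub>m 1\<^sub>m N + S * S"
  define Z where "Z = (8 * real t + 1) \<cdot>\<^sub>m 1\<^sub>m N + S * S"
  have c: "G \<in> carrier_mat N N" "Z \<in> carrier_mat N N" using S by (auto simp: G_def Z_def)
  have SS: "(S * S) $$ (i, j) = - g i j" if "i < N" "j < N" for i j
  proof -
    have "(S * S) $$ (i, j) = (\<Sum>k<N. S $$ (i, k) * S $$ (k, j))"
      by (rule index_mult_mat_sum[OF S S that])
    also have "\<dots> = (\<Sum>k<N. - (S $$ (i, k) * S $$ (j, k)))"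
    proof (intro sum.cong refl)
      fix k assume "k \<in> {..<N}"
      thus "S $$ (i, k) * S $$ (k, j) = - (S $$ (i, k) * S $$ (j, k))"
        using skew[of j k] that by simp
    qed
    finally show ?thesis by (simp add: g_def sum_negf)
  qed
  have p_sym: "p i j = p j i" for i j by (auto simp: p_def g_def mult.commute)
  have Gij: "G $$ (i, j) = - 2 * p i j" if "i < N" "j < N" for i j
    using S that by (simp add: G_def p_def SS del: index_mult_mat(1))
  have Zij: "Z $$ (i, j) = 2 * real m * of_bool (i = j) - 2 * p i j" if "i < N" "j < N" for i j
    using S that by (simp add: Z_def p_def m_def SS field_simps del: index_mult_mat(1))
  have quad: "poly_mat N [:b, 0, 1:] S = b \<cdot>\<^sub>m 1\<^sub>m N + S * S" for b
  proof -
    have "(1::real) \<cdot>\<^sub>m S = S" "(0::real) \<cdot>\<^sub>m 1\<^sub>m N + S = S" using S by (auto intro!: eq_matI)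
    thus ?thesis
      using poly_mat_pCons[OF S, of b "[:0, 1:]"] poly_mat_linear[OF S, of 0 1] by simp
  qed
  have "G ^\<^sub>m (2 * t) * Z = poly_mat N (seidel_poly t) S"
    by (simp only: seidel_poly_def poly_mat_mult[OF S] poly_mat_power[OF S] quad G_def Z_def)
  also have "seidel_poly t = char_poly S"
    using char_poly_seidel_mat[OF T t f] by (simp add: S_def)
  also have "poly_mat N (char_poly S) S = 0\<^sub>m N N" by (rule cayley_hamilton[OF S])
  finally have "G ^\<^sub>m (2 * t) * Z = 0\<^sub>m N N" .
  moreover have "transpose_mat G = G"
  proof (rule eq_matI)
    fix i j assume "i < dim_row G" "j < dim_col G"
    hence "i < N" "j < N" using c by auto
    thus "transpose_mat G $$ (i, j) = G $$ (i, j)" using c p_sym[of i j] by (simp add: Gij)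
  qed (use c in auto)
  \<comment> \<open>Symmetry of G reduces the exponent 2t from Cayley-Hamilton to 1.\<close>
  ultimately have GZ: "G * Z = 0\<^sub>m N N"
    using symmetric_pow_mult_eq_0[OF c(1) _ _ c(2), of "2 * t"] t by auto
  have idem: "(\<Sum>k<N. p i k * p k j) = real m * p i j" if ij: "i < N" "j < N" for i j
  proof -
    have "0 = (\<Sum>k<N. G $$ (i, k) * Z $$ (k, j))"
      using index_mult_mat_sum[OF c ij] ij by (simp add: GZ)
    also have "\<dots> = (\<Sum>k<N. 4 * (p i k * p k j) - 4 * real m * (if k = j then p i k else 0))"
      using ij by (intro sum.cong) (auto simp: Gij Zij algebra_simps)
    also have "\<dots> = 4 * (\<Sum>k<N. p i k * p k j) - 4 * real m * p i j"
      using ij by (simp add: sum_subtractf flip: sum_distrib_left)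
    finally show ?thesis by simp
  qed
  have diag: "p i i = 1" if i: "i < N" for i
  proof -
    have "g i i = (\<Sum>k<N. 1 - of_bool (k = i))"
      unfolding g_def
    proof (intro sum.cong refl)
      fix k assume "k \<in> {..<N}"
      thus "S $$ (i, k) * S $$ (i, k) = 1 - of_bool (k = i)"
        using S0[OF i] sign[of i k] i by (cases "k = i") auto
    qed
    also have "\<dots> = real N - 1" using i by (simp add: sum_subtractf of_bool_def)
    finally show ?thesis by (simp add: p_def N(2))
  qed
  have int: "p i j \<in> \<int>" if ij: "i < N" "j < N" for i j
  proof (cases "i = j")
    case True
    thus ?thesis using diag ij by simp
  next
    case False
    \<comment> \<open>The terms k = i and k = j vanish because S has zero diagonal, leaving 4t
      signs, an even number.\<close>
    have "g i j = (\<Sum>k\<in>{..<N} - {i, j}. S $$ (i, k) * S $$ (j, k))"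
      unfolding g_def using ij S0 by (intro sum.mono_neutral_right) auto
    moreover have "(\<Sum>k\<in>{..<N} - {i, j}. S $$ (i, k) * S $$ (j, k)) / 2 \<in> \<int>"
    proof (rule half_sum_signs_Ints)
      fix k assume k: "k \<in> {..<N} - {i, j}"
      show "S $$ (i, k) * S $$ (j, k) \<in> {1, -1}"
        using sign[of i k] sign[of j k] k ij by auto
    qed (use ij False in \<open>auto simp: card_Diff_subset N(2)\<close>)
    ultimately show ?thesis using False by (simp add: p_def)
  qed
  have p_sym': "p i j = p j i" if "i < N" "j < N" for i j by (rule p_sym)
  have m: "m > 0" by (simp add: m_def)
  show ?thesis
  proof (rule two_class_decomposition[of m p, folded N_def, OF m p_sym' diag int idem])
    fix d U
    assume U: "U \<subseteq> {..<N}" "card U = m" and d: "\<And>i. i < N \<Longrightarrow> d i \<in> {1, -1 :: real}"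
      and p: "\<And>i j. i < N \<Longrightarrow> j < N \<Longrightarrow> p i j = d i * d j * of_bool (i \<in> U \<longleftrightarrow> j \<in> U)"
    have gram: "(\<Sum>k<N. S $$ (i, k) * S $$ (j, k))
        = (4 * real t - 1) * of_bool (i = j) + 2 * (d i * d j * of_bool (i \<in> U \<longleftrightarrow> j \<in> U))"
      if "i < N" "j < N" for i j
      using p[OF that, symmetric] by (simp add: p_def g_def)
    show thesis
      by (rule skew_EW_of_two_classes[of t "\<lambda>i j. S $$ (i, j)", folded m_def, folded N_def,
            OF skew sign U d gram that])
  qed
qed

theorem theorem1p1:
  fixes t :: nat
  assumes "t > 0"
  shows "(\<exists>B. EW_matrix (4 * t + 2) B \<and> skew_symmetric_pm1 (4 * t + 2) B) \<longleftrightarrow>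
    (\<exists>n A. tournament_matrix n A \<and>
       char_poly A =
         (monom 1 3 - monom (2 * real t - 1) 2 - [:real t * (4 * real t - 1):]) *
         (monom 1 2 + monom 1 1 + [:real t:]) ^ (2 * t - 1))"
  unfolding tournament_poly_def[symmetric]
proof
  assume "\<exists>B. EW_matrix (4 * t + 2) B \<and> skew_symmetric_pm1 (4 * t + 2) B"
  thus "\<exists>n A. tournament_matrix n A \<and> char_poly A = tournament_poly t"
    using skew_EW_imp_tournament[OF assms] by metis
next
  assume "\<exists>n A. tournament_matrix n A \<and> char_poly A = tournament_poly t"
  then obtain n A where T: "tournament_matrix n A" and f: "char_poly A = tournament_poly t" by auto
  \<comment> \<open>The order of A is left open in the statement; the degree of the prescribed
    polynomial forces it to be 4t + 1.\<close>
  have "degree (char_poly A) = n"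
    using T degree_monic_char_poly[of A n] by (auto simp: tournament_matrix_def)
  hence "n = 4 * t + 1" using f degree_tournament_poly[OF assms] by simp
  thus "\<exists>B. EW_matrix (4 * t + 2) B \<and> skew_symmetric_pm1 (4 * t + 2) B"
    using tournament_imp_skew_EW[OF assms] T f by metis
qed

end
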